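(* Let $\Theta$ be either $\Theta_{\mathcal T}$ (with data from the tournament model) or $\Theta_{\mathcal G}$ (with data from the graph model). There is a universal constant $C<\infty$ such that for every integer $n\ge2$ and every $p\in[0,1]$ with $p\ge\frac{2\log n}{n}$, $$\sup_{\theta^*\in\Theta}\frac1{n^2}\,\mathbb E\|\hat\theta-\theta^*\|^2\le C\Big[\frac{(\log n)^2}{np}+\sqrt{\frac{\log n}{np}}\Big].$$
   Context: Notation: $[n]=\{1,\dots,n\}$; $S_n$ is the set of permutations of $[n]$; for an $n\times n$ matrix $\theta$ and $\pi\in S_n$, $(\theta\circ\pi)_{ij}=\theta_{\pi(i),\pi(j)}$; $\|\cdot\|$ is the Frobenius norm; $\log$ is the natural logarithm. Parameter spaces: $\mathcal T$ is the set of $\theta\in[0,1]^{n\times n}$ such that $\theta_{ij}\le\theta_{ik}$ whenever $i\ne k$, $i\ne j$, $k<j$; $\theta_{ji}=1-\theta_{ij}$ for all $i\neq j$; $\theta_{ii}=0$ for all $i$; and $\theta_{ij}\le\frac12$ for all $i<j$. $\mathcal G$ is the set of $\theta\in[0,1]^{n\times n}$ such that $\theta_{ij}\le\theta_{ik}$ whenever $i\ne k$, $i\ne j$, $j<k$; $\theta_{ji}=\theta_{ij}$ for all $i\ne j$; and $\theta_{ii}=0$ for all $i$. Set $\Theta_{\mathcal T}=\{\theta\circ\pi:\theta\in\mathcal T,\pi\in S_n\}$ and $\Theta_{\mathcal G}=\{\theta\circ\pi:\theta\in\mathcal G,\pi\in S_n\}$. Data with true parameter $\theta^*$ and observation probability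 $p$: for $i<j$ there are independent outcomes with law $\mathrm{Bern}(\theta^*_{ij})$; each above-diagonal entry is observed with probability $p$, independently over entries and independently of the outcomes. For $i<j$ set $y_{ij}$ equal to the outcome if it is observed and $y_{ij}=\frac12$ if it is missing. The lower triangle is $y_{ji}=1-y_{ij}$ in the tournament model and $y_{ji}=y_{ij}$ in the graph model ($i<j$), and $y_{ii}=0$. Let $\hat p$ be the number of observed above-diagonal entries divided by $\binom n2$. Estimator: let $r_i=\sum_{j=1}^n y_{ij}$ and let $\hat\sigma$ be a permutation with $r_{\hat\sigma(1)}\le\dots\le r_{\hat\sigma(n)}$, ties being broken uniformly at random. Let $J$ be the $n\times n$ matrix with $J_{ij}=1$ for $i\ne j$ and $J_{ii}=0$. Let $\mathrm{Proj}$ be the Euclidean (Frobenius) projection onto the closed convex set $\mathcal T$ in the tournament model, and onto $\mathcal G$ in the graph model. Then $$\hat\theta=\mathrm{Proj}\Big(\big(\tfrac{y-J/2}{\hat p}+\tfrac J2\big)\circ\hat\sigma\Big)\circ\hat\sigma^{-1}\ \text{ if }\hat p\ge\tfrac1n,\qquad \hat\theta=\tfrac J2\ \text{ otherwise}.$$ *)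

theory Defs
  imports "HOL-Probability.Probability" "HOL-Combinatorics.Permutations"
begin

text \<open>
  An \<open>n \<times> n\<close> matrix is a function on pairs of naturals that vanishes outside \<open>{1..n} \<times> {1..n}\<close>,
  so that equality of functions is equality of matrices.
\<close>

type_synonym mat = "nat \<Rightarrow> nat \<Rightarrow> real"

datatype model = Tournament | Graph

definition matrices :: "nat \<Rightarrow> mat set" where
  "matrices n = {\<theta>. \<forall>i j. i \<notin> {1..n} \<or> j \<notin> {1..n} \<longrightarrow> \<theta> i j = 0}"

definition unit_matrices :: "nat \<Rightarrow> mat set" where
  "unit_matrices n = {\<theta> \<in> matrices n. \<forall>i\<in>{1..n}. \<forall>j\<in>{1..n}. \<theta> i j \<in> {0..1}}"

definition frob_norm :: "nat \<Rightarrow> mat \<Rightarrow> real" where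
  "frob_norm n A = sqrt (\<Sum>i\<in>{1..n}. \<Sum>j\<in>{1..n}. (A i j)\<^sup>2)"

definition permute :: "mat \<Rightarrow> (nat \<Rightarrow> nat) \<Rightarrow> mat" where
  "permute \<theta> \<pi> = (\<lambda>i j. \<theta> (\<pi> i) (\<pi> j))"

definition tournament_params :: "nat \<Rightarrow> mat set" where
  "tournament_params n = {\<theta> \<in> unit_matrices n.
     (\<forall>i\<in>{1..n}. \<forall>j\<in>{1..n}. \<forall>k\<in>{1..n}. i \<noteq> k \<and> i \<noteq> j \<and> k < j \<longrightarrow> \<theta> i j \<le> \<theta> i k) \<and>
     (\<forall>i\<in>{1..n}. \<forall>j\<in>{1..n}. i \<noteq> j \<longrightarrow> \<theta> j i = 1 - \<theta> i j) \<and>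
     (\<forall>i\<in>{1..n}. \<theta> i i = 0) \<and>
     (\<forall>i\<in>{1..n}. \<forall>j\<in>{1..n}. i < j \<longrightarrow> \<theta> i j \<le> 1 / 2)}"

definition graph_params :: "nat \<Rightarrow> mat set" where
  "graph_params n = {\<theta> \<in> unit_matrices n.
     (\<forall>i\<in>{1..n}. \<forall>j\<in>{1..n}. \<forall>k\<in>{1..n}. i \<noteq> k \<and> i \<noteq> j \<and> j < k \<longrightarrow> \<theta> i j \<le> \<theta> i k) \<and>
     (\<forall>i\<in>{1..n}. \<forall>j\<in>{1..n}. i \<noteq> j \<longrightarrow> \<theta> j i = \<theta> i j) \<and>
     (\<forall>i\<in>{1..n}. \<theta> i i = 0)}"

fun ordered_params :: "model \<Rightarrow> nat \<Rightarrow> mat set" where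
  "ordered_params Tournament n = tournament_params n"
| "ordered_params Graph n = graph_params n"

definition Theta :: "model \<Rightarrow> nat \<Rightarrow> mat set" where
  "Theta m n = {permute \<theta> \<pi> |\<theta> \<pi>. \<theta> \<in> ordered_params m n \<and> \<pi> permutes {1..n}}"

definition upper :: "nat \<Rightarrow> (nat \<times> nat) set" where
  "upper n = {(i, j). 1 \<le> i \<and> i < j \<and> j \<le> n}"

text \<open>
  In the following, \<open>Z e\<close> is the binary outcome of the entry \<open>e\<close> above the diagonal and
  \<open>D e\<close> states that this entry is observed.
\<close>

definition upper_datum :: "(nat \<times> nat \<Rightarrow> bool) \<Rightarrow> (nat \<times> nat \<Rightarrow> bool) \<Rightarrow> nat \<times> nat \<Rightarrow> real" where
  "upper_datum Z D e = (if D e then of_bool (Z e) else 1 / 2)"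

definition data_matrix ::
    "model \<Rightarrow> nat \<Rightarrow> (nat \<times> nat \<Rightarrow> bool) \<Rightarrow> (nat \<times> nat \<Rightarrow> bool) \<Rightarrow> mat" where
  "data_matrix m n Z D = (\<lambda>i j.
     if (i, j) \<in> upper n then upper_datum Z D (i, j)
     else if (j, i) \<in> upper n then
       (case m of Tournament \<Rightarrow> 1 - upper_datum Z D (j, i) | Graph \<Rightarrow> upper_datum Z D (j, i))
     else 0)"

definition p_hat :: "nat \<Rightarrow> (nat \<times> nat \<Rightarrow> bool) \<Rightarrow> real" where
  "p_hat n D = real (card {e \<in> upper n. D e}) / real (n choose 2)"

definition row_sum :: "nat \<Rightarrow> mat \<Rightarrow> nat \<Rightarrow> real" where
  "row_sum n y i = (\<Sum>j\<in>{1..n}. y i j)"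

definition sorting_perms :: "nat \<Rightarrow> mat \<Rightarrow> (nat \<Rightarrow> nat) set" where
  "sorting_perms n y = {\<sigma>. \<sigma> permutes {1..n} \<and>
     (\<forall>i\<in>{1..n}. \<forall>j\<in>{1..n}. i \<le> j \<longrightarrow> row_sum n y (\<sigma> i) \<le> row_sum n y (\<sigma> j))}"

definition J :: "nat \<Rightarrow> mat" where
  "J n = (\<lambda>i j. if i \<in> {1..n} \<and> j \<in> {1..n} \<and> i \<noteq> j then 1 else 0)"

text \<open>
  The library's \<open>closest_point\<close> needs a metric space as its type, hence the explicit minimiser;
  it is unique when \<open>S\<close> is a nonempty closed convex set of \<open>n \<times> n\<close> matrices.
\<close>

definition proj :: "nat \<Rightarrow> mat set \<Rightarrow> mat \<Rightarrow> mat" where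
  "proj n S A = arg_min_on (\<lambda>B. frob_norm n (\<lambda>i j. A i j - B i j)) S"

definition theta_hat :: "model \<Rightarrow> nat \<Rightarrow> mat \<Rightarrow> real \<Rightarrow> (nat \<Rightarrow> nat) \<Rightarrow> mat" where
  "theta_hat m n y ph \<sigma> =
     (if ph \<ge> 1 / real n
      then permute (proj n (ordered_params m n)
             (permute (\<lambda>i j. (y i j - J n i j / 2) / ph + J n i j / 2) \<sigma>)) (inv \<sigma>)
      else (\<lambda>i j. J n i j / 2))"

text \<open>
  The law of the estimator. Given the data, uniform random tie breaking makes the sorting
  permutation uniform among all permutations that sort the row sums.
\<close>

definition estimator_pmf :: "model \<Rightarrow> nat \<Rightarrow> real \<Rightarrow> mat \<Rightarrow> mat pmf" where
  "estimator_pmf m n p \<theta> = do {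
     Z \<leftarrow> Pi_pmf (upper n) False (\<lambda>(i, j). bernoulli_pmf (\<theta> i j));
     D \<leftarrow> Pi_pmf (upper n) False (\<lambda>_. bernoulli_pmf p);
     \<sigma> \<leftarrow> pmf_of_set (sorting_perms n (data_matrix m n Z D));
     return_pmf (theta_hat m n (data_matrix m n Z D) (p_hat n D) \<sigma>)
   }"

definition risk :: "model \<Rightarrow> nat \<Rightarrow> real \<Rightarrow> mat \<Rightarrow> real" where
  "risk m n p \<theta> = measure_pmf.expectation (estimator_pmf m n p \<theta>)
     (\<lambda>t. (frob_norm n (\<lambda>i j. t i j - \<theta> i j))\<^sup>2)"

end

theory Submission imports Defs begin

text \<open>
  With \<open>x = ln n / (n p)\<close>, the normalised risk is at most a constant times \<open>sqrt x\<close>.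
  Write \<open>\<theta> = permute t \<pi>\<close> with \<open>t\<close> ordered. Comparing the projection \<open>P\<close> with the competitor \<open>t\<close>
  bounds the loss by a noise term, \<open>\<langle>\<xi> \<circ> \<sigma>, P - t\<rangle> / p\<close>, and a sorting term,
  \<open>\<parallel>\<theta> \<circ> \<sigma> - t\<parallel>\<^sup>2\<close>. For ordered matrices the \<open>L\<^sup>1\<close> distance of two rows is, up to a
  constant, the difference of their sums, so the sorting term is at most \<open>n / p\<close> times the largest
  row sum of the noise. Since ordered matrices have monotone columns, the noise term is dominated by
  a maximum over column-wise thresholds and relabellings. There are only \<open>exp (O (n ln n))\<close> of
  these, and a union bound on moment generating functions with \<open>\<lambda> = sqrt x / 2\<close> suffices for
  both terms.
\<close>

section \<open>Maximal inequalities\<close>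

text \<open>The sorting permutation is computed from the data that carry the noise, so nothing is
  conditioned on \<open>\<sigma>\<close>: every relabelling is built into the finite family of test
  matrices. This adds order \<open>n ln n\<close> to the logarithm of its size, as much as the
  thresholds themselves. Exponential moments are controlled by the variance, of order
  \<open>p\<close> per entry; a bound by the range alone would lose this factor. For test matrices
  of squared norm at most \<open>n^2\<close> the expected maximum is then, up to constants, at most
  \<open>n ln n / \<lambda> + \<lambda> p n^2\<close>. As \<open>n ln n = x n^2 p\<close>, the two
  terms balance at \<lambda> of order \<open>sqrt x\<close> and give \<open>n^2 p sqrt x\<close>, to
  be divided by \<open>p\<close>. The lower bound on \<open>p\<close> means
  \<open>x \<le> 1 / 2\<close>, which keeps each exponent within the range of the quadratic bound on
  \<open>exp\<close>. Dividing the data by \<open>p_hat\<close> instead of \<open>p\<close> adds an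
  error proportional to \<open>\<bar>p_hat - p\<bar> / p\<close>. The event
  \<open>p_hat < p / 2\<close> is charged to the same quantity, through the trivial loss
  \<open>n^2\<close>.\<close>

lemma finite_set_Pi_pmf_bool:
  fixes q :: "'a \<Rightarrow> bool pmf"
  assumes "finite A"
  shows "finite (set_pmf (Pi_pmf A False q))"
proof -
  have "finite (PiE_dflt A False (set_pmf \<circ> q))"
    by (rule finite_PiE_dflt) (use assms in auto)
  thus ?thesis by (simp add: set_Pi_pmf assms)
qed

lemma expectation_bind_finite:
  fixes h :: "'b \<Rightarrow> real"
  assumes "finite (set_pmf p)" "\<And>x. x \<in> set_pmf p \<Longrightarrow> finite (set_pmf (f x))"
  shows "measure_pmf.expectation (p \<bind> f) h
    = measure_pmf.expectation p (\<lambda>x. measure_pmf.expectation (f x) h)"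
  by (subst pmf_expectation_bind[OF assms], simp_all, subst integral_measure_pmf[OF assms(1)]) simp_all

lemma expectation_pair_finite:
  fixes h :: "'a \<times> 'b \<Rightarrow> real"
  assumes "finite (set_pmf p)" "finite (set_pmf q)"
  shows "measure_pmf.expectation (pair_pmf p q) h
    = measure_pmf.expectation p (\<lambda>x. measure_pmf.expectation q (\<lambda>y. h (x, y)))"
  unfolding pair_pmf_def
  by (subst expectation_bind_finite; (subst expectation_bind_finite)?) (use assms in auto)

lemma exp_le_one_plus_quadratic:
  fixes u :: real
  assumes "\<bar>u\<bar> \<le> 1"
  shows "exp u \<le> 1 + u + u\<^sup>2"
proof (cases "u \<ge> 0")
  case True
  thus ?thesis using exp_bound[of u] assms by simp
next
  case False
  define w where "w = - u"
  have w: "0 \<le> w" "w \<le> 1" using False assms by (auto simp: w_def)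
  have le: "1 + w + w\<^sup>2 / 2 \<le> exp w" using exp_lower_Taylor_quadratic[OF w(1)] by simp
  have nonneg: "0 \<le> 1 - w + w\<^sup>2" using w by simp
  \<comment> \<open>The Taylor lower bound for \<open>exp w\<close> times the candidate
    \<open>1 - w + w^2\<close> is at least 1, so the candidate dominates
    \<open>exp (- w)\<close>.\<close>
  have "1 \<le> 1 + w\<^sup>2 / 2 + w^3 / 2 + w^4 / 2" using w by simp
  also have "\<dots> = (1 + w + w\<^sup>2 / 2) * (1 - w + w\<^sup>2)"
    by (simp add: field_simps power2_eq_square power3_eq_cube power4_eq_xxxx)
  also have "\<dots> \<le> exp w * (1 - w + w\<^sup>2)" using le nonneg by (rule mult_right_mono)
  finally have "exp (- w) \<le> 1 - w + w\<^sup>2"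
    by (simp add: exp_minus field_simps)
  thus ?thesis by (simp add: w_def)
qed

text \<open>Under the quadratic bound on \<open>exp\<close> the linear term vanishes in the mean;
  \<open>1 + v \<le> exp v\<close> then gives a form that multiplies over independent
  factors.\<close>

lemma expectation_exp_le:
  fixes h :: "'a \<Rightarrow> real"
  assumes fin: "finite (set_pmf M)"
    and mean: "measure_pmf.expectation M h = 0"
    and bound: "\<And>x. x \<in> set_pmf M \<Longrightarrow> \<bar>h x\<bar> \<le> 1"
    and var: "measure_pmf.expectation M (\<lambda>x. (h x)\<^sup>2) \<le> v"
  shows "measure_pmf.expectation M (\<lambda>x. exp (h x)) \<le> exp v"
proof -
  note [simp] = integrable_measure_pmf_finite[OF fin]
  have "measure_pmf.expectation M (\<lambda>x. exp (h x))
      \<le> measure_pmf.expectation M (\<lambda>x. 1 + h x + (h x)\<^sup>2)"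
    by (rule integral_mono_AE)
       (use bound in \<open>auto simp: AE_measure_pmf_iff intro: exp_le_one_plus_quadratic\<close>)
  also have "\<dots> \<le> 1 + v" using mean var by simp
  also have "\<dots> \<le> exp v" by (rule exp_ge_add_one_self)
  finally show ?thesis .
qed

text \<open>Outcomes and observations follow two separate product laws, but each summand sees only
  the pair at its own entry. Integrating over \<open>D\<close> and then over \<open>Z\<close>
  factorises the exponential, and regrouping leaves one expectation under the pair law per
  entry.\<close>

lemma expectation_exp_sum_le:
  fixes P Q :: "'a \<Rightarrow> bool pmf" and h :: "'a \<Rightarrow> bool \<Rightarrow> bool \<Rightarrow> real"
  assumes A: "finite A"
    and mean: "\<And>e. e \<in> A \<Longrightarrow>
      measure_pmf.expectation (pair_pmf (P e) (Q e)) (\<lambda>(z, d). h e z d) = 0"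
    and bound: "\<And>e z d. e \<in> A \<Longrightarrow> \<bar>h e z d\<bar> \<le> 1"
    and var: "\<And>e. e \<in> A \<Longrightarrow>
      measure_pmf.expectation (pair_pmf (P e) (Q e)) (\<lambda>(z, d). (h e z d)\<^sup>2) \<le> v e"
  shows "measure_pmf.expectation (pair_pmf (Pi_pmf A False P) (Pi_pmf A False Q))
      (\<lambda>(Z, D). exp (\<Sum>e\<in>A. h e (Z e) (D e))) \<le> exp (\<Sum>e\<in>A. v e)"
proof -
  have fin [simp]: "finite (set_pmf M)" for M :: "bool pmf" by simp
  note [simp] = finite_set_Pi_pmf_bool[OF A]
  note int [simp] = integrable_measure_pmf_finite[OF fin]
  let ?g = "\<lambda>e z. measure_pmf.expectation (Q e) (\<lambda>d. exp (h e z d))"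
  have "measure_pmf.expectation (pair_pmf (Pi_pmf A False P) (Pi_pmf A False Q))
      (\<lambda>(Z, D). exp (\<Sum>e\<in>A. h e (Z e) (D e)))
    = measure_pmf.expectation (Pi_pmf A False P) (\<lambda>Z.
        measure_pmf.expectation (Pi_pmf A False Q) (\<lambda>D. \<Prod>e\<in>A. exp (h e (Z e) (D e))))"
    by (subst expectation_pair_finite) (simp_all add: exp_sum A)
  also have "\<dots> = measure_pmf.expectation (Pi_pmf A False P) (\<lambda>Z. \<Prod>e\<in>A. ?g e (Z e))"
    by (subst expectation_prod_Pi_pmf[OF A]) simp_all
  also have "\<dots> = (\<Prod>e\<in>A. measure_pmf.expectation (P e) (?g e))"
    by (rule expectation_prod_Pi_pmf[OF A]) (auto intro: integral_nonneg_AE)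
  also have "\<dots> = (\<Prod>e\<in>A. measure_pmf.expectation (pair_pmf (P e) (Q e)) (\<lambda>(z, d). exp (h e z d)))"
    by (simp add: expectation_pair_finite)
  also have "\<dots> \<le> (\<Prod>e\<in>A. exp (v e))"
  proof (rule prod_mono, intro conjI)
    fix e assume e: "e \<in> A"
    show "0 \<le> measure_pmf.expectation (pair_pmf (P e) (Q e)) (\<lambda>(z, d). exp (h e z d))"
      by (rule integral_nonneg_AE) auto
    have "measure_pmf.expectation (pair_pmf (P e) (Q e)) (\<lambda>x. exp (case x of (z, d) \<Rightarrow> h e z d)) \<le> exp (v e)"
      by (rule expectation_exp_le) (use mean[OF e] bound[OF e] var[OF e] in \<open>auto simp: case_prod_unfold\<close>)
    thus "measure_pmf.expectation (pair_pmf (P e) (Q e)) (\<lambda>(z, d). exp (h e z d)) \<le> exp (v e)"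
      by (simp add: case_prod_unfold)
  qed
  also have "\<dots> = exp (\<Sum>e\<in>A. v e)" by (simp add: exp_sum A)
  finally show ?thesis .
qed

lemma expectation_Max_le:
  fixes X :: "'b \<Rightarrow> 'a \<Rightarrow> real"
  assumes fin: "finite (set_pmf M)" and F: "finite F" "F \<noteq> {}" and l: "l > 0"
    and mgf: "\<And>b. b \<in> F \<Longrightarrow> measure_pmf.expectation M (\<lambda>x. exp (l * X b x)) \<le> exp v"
  shows "measure_pmf.expectation M (\<lambda>x. Max ((\<lambda>b. X b x) ` F)) \<le> (ln (card F) + v) / l"
proof -
  note [simp] = integrable_measure_pmf_finite[OF fin]
  have card: "real (card F) > 0" using F by (simp add: card_gt_0_iff)
  \<comment> \<open>With this \<open>K\<close> the sum of the exponentials, scaled by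
    \<open>exp (- K)\<close>, has mean at most 1, which cancels the \<open>- 1\<close> of the linear
    bound.\<close>
  define K where "K = ln (card F) + v"
  have expK: "exp K = card F * exp v" using card by (simp add: K_def exp_add)
  have pt: "Max ((\<lambda>b. X b x) ` F) \<le> (K - 1 + exp (- K) * (\<Sum>b\<in>F. exp (l * X b x))) / l" for x
  proof -
    have "Max ((\<lambda>b. X b x) ` F) \<in> (\<lambda>b. X b x) ` F" using F by (intro Max_in) auto
    then obtain b where b: "b \<in> F" "Max ((\<lambda>b. X b x) ` F) = X b x" by auto
    \<comment> \<open>a linear bound in the exponentials, so that no Jensen inequality for \<open>ln\<close> is needed\<close>
    have "1 + (l * X b x - K) \<le> exp (l * X b x - K)" by (rule exp_ge_add_one_self)
    also have "\<dots> = exp (- K) * exp (l * X b x)" by (simp add: exp_diff exp_minus field_simps)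
    also have "\<dots> \<le> exp (- K) * (\<Sum>b\<in>F. exp (l * X b x))"
      using member_le_sum[OF b(1), of "\<lambda>b. exp (l * X b x)"] F by simp
    finally show ?thesis using l b(2) by (simp add: field_simps)
  qed
  have "measure_pmf.expectation M (\<lambda>x. Max ((\<lambda>b. X b x) ` F))
      \<le> measure_pmf.expectation M (\<lambda>x. (K - 1 + exp (- K) * (\<Sum>b\<in>F. exp (l * X b x))) / l)"
    by (rule integral_mono_AE) (use pt in auto)
  also have "\<dots> = (K - 1 + exp (- K) * (\<Sum>b\<in>F. measure_pmf.expectation M (\<lambda>x. exp (l * X b x)))) / l"
    by simp
  also have "\<dots> \<le> (K - 1 + exp (- K) * (\<Sum>b\<in>F. exp v)) / l"
    using l mgf by (intro divide_right_mono add_mono mult_left_mono sum_mono) auto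
  also have "\<dots> = K / l"
    using expK card by (simp add: exp_minus field_simps)
  finally show ?thesis by (simp add: K_def)
qed

section \<open>Ordered matrices\<close>

text \<open>Deviations from 1/2 are antisymmetric for tournaments and symmetric for graphs; this
  sign lets the later arguments treat both models at once.\<close>

fun model_sign :: "model \<Rightarrow> real" where
  "model_sign Tournament = -1"
| "model_sign Graph = 1"

lemma abs_model_sign [simp]: "\<bar>model_sign m\<bar> = 1"
  by (cases m) auto

lemma ordered_params_unit_matrices: "ordered_params m n \<subseteq> unit_matrices n"
  by (cases m) (auto simp: tournament_params_def graph_params_def)

lemma ordered_params_outside:
  assumes "\<theta> \<in> ordered_params m n" "i \<notin> {1..n} \<or> j \<notin> {1..n}"
  shows "\<theta> i j = 0"
  using assms ordered_params_unit_matrices[of m n]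
  unfolding unit_matrices_def matrices_def by blast

lemma ordered_params_bounds:
  assumes "\<theta> \<in> ordered_params m n"
  shows "0 \<le> \<theta> i j" "\<theta> i j \<le> 1"
proof -
  have "\<theta> i j \<in> {0..1}" if "i \<in> {1..n}" "j \<in> {1..n}"
    using assms that ordered_params_unit_matrices[of m n] unfolding unit_matrices_def by blast
  thus "0 \<le> \<theta> i j" "\<theta> i j \<le> 1"
    using ordered_params_outside[OF assms, of i j] by fastforce+
qed

lemma ordered_params_diag:
  assumes "\<theta> \<in> ordered_params m n"
  shows "\<theta> i i = 0"
proof (cases "i \<in> {1..n}")
  case True
  thus ?thesis using assms
    by (cases m) (simp_all add: tournament_params_def graph_params_def)
next
  case False
  thus ?thesis using ordered_params_outside[OF assms] by blast
qed

lemma ordered_params_flip: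
  assumes "\<theta> \<in> ordered_params m n" "i \<in> {1..n}" "j \<in> {1..n}" "i \<noteq> j"
  shows "\<theta> j i - 1 / 2 = model_sign m * (\<theta> i j - 1 / 2)"
proof (cases m)
  case Tournament
  with assms have "\<theta> \<in> tournament_params n" by simp
  with assms have "\<theta> j i = 1 - \<theta> i j" unfolding tournament_params_def by blast
  with Tournament show ?thesis by simp
next
  case Graph
  with assms have "\<theta> \<in> graph_params n" by simp
  with assms have "\<theta> j i = \<theta> i j" unfolding graph_params_def by blast
  with Graph show ?thesis by simp
qed

text \<open>The rows decrease for tournaments and increase for graphs, but the columns increase in both models.\<close>

lemma ordered_params_column_mono:
  assumes \<theta>: "\<theta> \<in> ordered_params m n" and ij: "i \<in> {1..n}" "i' \<in> {1..n}" "j \<in> {1..n}" "i < i'" "j \<noteq> i" "j \<noteq> i'"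
  shows "\<theta> i j \<le> \<theta> i' j"
proof -
  have "model_sign m * \<theta> j i \<le> model_sign m * \<theta> j i'"
  proof (cases m)
    case Tournament
    with assms have "\<theta> \<in> tournament_params n" by simp
    with assms have "\<theta> j i' \<le> \<theta> j i" unfolding tournament_params_def by blast
    with Tournament show ?thesis by simp
  next
    case Graph
    with assms have "\<theta> \<in> graph_params n" by simp
    with assms have "\<theta> j i \<le> \<theta> j i'" unfolding graph_params_def by blast
    with Graph show ?thesis by simp
  qed
  moreover have "\<theta> i j - 1 / 2 = model_sign m * (\<theta> j i - 1 / 2)"
    "\<theta> i' j - 1 / 2 = model_sign m * (\<theta> j i' - 1 / 2)"
    using ij by (auto intro!: ordered_params_flip[OF \<theta>])
  ultimately show ?thesis by (simp add: right_diff_distrib)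
qed

lemma ordered_params_flip_le:
  assumes \<theta>: "\<theta> \<in> ordered_params m n" and ij: "i \<in> {1..n}" "j \<in> {1..n}" "i < j"
  shows "\<theta> i j \<le> \<theta> j i"
proof (cases m)
  case Tournament
  with assms have "\<theta> \<in> tournament_params n" by simp
  with assms have "\<theta> i j \<le> 1 / 2" unfolding tournament_params_def by blast
  with Tournament show ?thesis using ordered_params_flip[OF \<theta>, of i j] ij by simp
next
  case Graph
  thus ?thesis using ordered_params_flip[OF \<theta>, of i j] ij by simp
qed

lemma row_sum_gap:
  assumes \<theta>: "\<theta> \<in> ordered_params m n" and ab: "a \<in> {1..n}" "b \<in> {1..n}" "a < b"
  shows "(\<Sum>j\<in>{1..n} - {a, b}. \<bar>\<theta> b j - \<theta> a j\<bar>) \<le> row_sum n \<theta> b - row_sum n \<theta> a"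
proof -
  have split: "row_sum n \<theta> c = (\<Sum>j\<in>{1..n} - {a, b}. \<theta> c j) + (\<theta> c a + \<theta> c b)" for c
    unfolding row_sum_def using ab by (subst sum.subset_diff[of "{a, b}"]) auto
  have "(\<Sum>j\<in>{1..n} - {a, b}. \<bar>\<theta> b j - \<theta> a j\<bar>) = (\<Sum>j\<in>{1..n} - {a, b}. \<theta> b j - \<theta> a j)"
    using ordered_params_column_mono[OF \<theta> ab(1,2) _ ab(3)] by (intro sum.cong refl) auto
  thus ?thesis
    using split[of a] split[of b] ordered_params_flip_le[OF \<theta> ab] ordered_params_diag[OF \<theta>]
    by (simp add: sum_subtractf)
qed

lemma row_sum_mono:
  assumes \<theta>: "\<theta> \<in> ordered_params m n" and ab: "a \<in> {1..n}" "b \<in> {1..n}" "a \<le> b"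
  shows "row_sum n \<theta> a \<le> row_sum n \<theta> b"
proof (cases "a = b")
  case False
  hence "a < b" using ab by simp
  from row_sum_gap[OF \<theta> ab(1,2) this] show ?thesis
    by (smt (verit) sum_nonneg abs_ge_zero)
qed simp

text \<open>The additive 2 pays for the positions \<open>a\<close> and \<open>b\<close>, where the
  zero diagonal breaks monotonicity and each difference is at most 1.\<close>

lemma row_distance_le:
  assumes \<theta>: "\<theta> \<in> ordered_params m n" and ab: "a \<in> {1..n}" "b \<in> {1..n}"
  shows "(\<Sum>j\<in>{1..n}. \<bar>\<theta> a j - \<theta> b j\<bar>) \<le> \<bar>row_sum n \<theta> a - row_sum n \<theta> b\<bar> + 2"
proof -
  have le1: "\<bar>\<theta> c j - \<theta> d j\<bar> \<le> 1" for c d j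
    using ordered_params_bounds[OF \<theta>, of c j] ordered_params_bounds[OF \<theta>, of d j] by simp
  have gap: "(\<Sum>j\<in>{1..n} - {a, b}. \<bar>\<theta> a j - \<theta> b j\<bar>) \<le> \<bar>row_sum n \<theta> a - row_sum n \<theta> b\<bar>"
  proof (cases a b rule: linorder_cases)
    case less
    thus ?thesis using row_sum_gap[OF \<theta> ab less] by (simp add: abs_minus_commute)
  next
    case greater
    thus ?thesis using row_sum_gap[OF \<theta> ab(2,1) greater] by (simp add: insert_commute)
  qed simp
  have "(\<Sum>j\<in>{1..n}. \<bar>\<theta> a j - \<theta> b j\<bar>)
      = (\<Sum>j\<in>{1..n} - {a, b}. \<bar>\<theta> a j - \<theta> b j\<bar>) + (\<Sum>j\<in>{a, b}. \<bar>\<theta> a j - \<theta> b j\<bar>)"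
    using ab by (subst sum.subset_diff[of "{a, b}"]) auto
  moreover have "(\<Sum>j\<in>{a, b}. \<bar>\<theta> a j - \<theta> b j\<bar>) \<le> 2"
    using le1[of a a b] le1[of a b b] by (cases "a = b") auto
  ultimately show ?thesis using gap by simp
qed

text \<open>Off the positions \<open>a\<close> and \<open>b\<close>, a column difference is a row
  difference up to \<open>model_sign\<close>. The 4 is 2 for these positions plus the 2 of
  \<open>row_distance_le\<close>.\<close>

lemma column_distance_le:
  assumes \<theta>: "\<theta> \<in> ordered_params m n" and ab: "a \<in> {1..n}" "b \<in> {1..n}"
  shows "(\<Sum>i\<in>{1..n}. \<bar>\<theta> i a - \<theta> i b\<bar>) \<le> \<bar>row_sum n \<theta> a - row_sum n \<theta> b\<bar> + 4"
proof -
  have le1: "\<bar>\<theta> i a - \<theta> i b\<bar> \<le> 1" for i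
    using ordered_params_bounds[OF \<theta>, of i a] ordered_params_bounds[OF \<theta>, of i b] by simp
  have "(\<Sum>i\<in>{1..n}. \<bar>\<theta> i a - \<theta> i b\<bar>)
      = (\<Sum>i\<in>{1..n} - {a, b}. \<bar>\<theta> i a - \<theta> i b\<bar>) + (\<Sum>i\<in>{a, b}. \<bar>\<theta> i a - \<theta> i b\<bar>)"
    using ab by (subst sum.subset_diff[of "{a, b}"]) auto
  also have "(\<Sum>i\<in>{a, b}. \<bar>\<theta> i a - \<theta> i b\<bar>) \<le> 2"
    using le1[of a] le1[of b] by (cases "a = b") auto
  also have "(\<Sum>i\<in>{1..n} - {a, b}. \<bar>\<theta> i a - \<theta> i b\<bar>) = (\<Sum>i\<in>{1..n} - {a, b}. \<bar>\<theta> a i - \<theta> b i\<bar>)"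
  proof (intro sum.cong refl)
    fix i assume i: "i \<in> {1..n} - {a, b}"
    have "\<theta> i a - \<theta> i b = model_sign m * (\<theta> a i - \<theta> b i)"
      using ordered_params_flip[OF \<theta>, of a i] ordered_params_flip[OF \<theta>, of b i] i ab
      by (auto simp: right_diff_distrib)
    thus "\<bar>\<theta> i a - \<theta> i b\<bar> = \<bar>\<theta> a i - \<theta> b i\<bar>" by (simp add: abs_mult)
  qed
  also have "\<dots> \<le> (\<Sum>i\<in>{1..n}. \<bar>\<theta> a i - \<theta> b i\<bar>)" by (intro sum_mono2) auto
  also have "\<dots> \<le> \<bar>row_sum n \<theta> a - row_sum n \<theta> b\<bar> + 2" by (rule row_distance_le[OF \<theta> ab])
  finally show ?thesis by simp
qed

section \<open>Distance between an ordered matrix and its relabelling\<close>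

definition frob_inner :: "nat \<Rightarrow> mat \<Rightarrow> mat \<Rightarrow> real" where
  "frob_inner n A B = (\<Sum>i\<in>{1..n}. \<Sum>j\<in>{1..n}. A i j * B i j)"

lemma frob_norm_sq: "(frob_norm n A)\<^sup>2 = frob_inner n A A"
  unfolding frob_norm_def frob_inner_def
  by (simp add: sum_nonneg power2_eq_square)

lemma sum_permute2:
  fixes f :: "nat \<Rightarrow> nat \<Rightarrow> real"
  assumes "\<sigma> permutes {1..n}"
  shows "(\<Sum>i\<in>{1..n}. \<Sum>j\<in>{1..n}. f (\<sigma> i) (\<sigma> j)) = (\<Sum>i\<in>{1..n}. \<Sum>j\<in>{1..n}. f i j)"
proof -
  have "(\<Sum>j\<in>{1..n}. f i (\<sigma> j)) = (\<Sum>j\<in>{1..n}. f i j)" for i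
    using sum.permute[OF assms, of "f i"] by (simp add: comp_def)
  thus ?thesis using sum.permute[OF assms, of "\<lambda>i. \<Sum>j\<in>{1..n}. f i j"] by (simp add: comp_def)
qed

lemma frob_inner_permute:
  assumes "\<sigma> permutes {1..n}"
  shows "frob_inner n (permute A \<sigma>) (permute B \<sigma>) = frob_inner n A B"
  unfolding frob_inner_def permute_def
  by (rule sum_permute2[OF assms, of "\<lambda>i j. A i j * B i j"])

text \<open>Entries lie in [0,1], so squares are at most absolute values. Passing through
  \<open>\<theta> i (\<tau> j)\<close> moves one index at a time: \<open>d + 2\<close> for each row
  and \<open>d + 4\<close> for each column.\<close>

lemma permuted_ordered_distance_le:
  assumes \<theta>: "\<theta> \<in> ordered_params m n" and \<tau>: "\<tau> permutes {1..n}"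
    and d: "\<And>i. i \<in> {1..n} \<Longrightarrow> \<bar>row_sum n \<theta> (\<tau> i) - row_sum n \<theta> i\<bar> \<le> d"
  shows "(frob_norm n (\<lambda>i j. permute \<theta> \<tau> i j - \<theta> i j))\<^sup>2 \<le> n * (2 * d + 6)"
proof -
  have \<tau>_in: "\<tau> i \<in> {1..n}" if "i \<in> {1..n}" for i
    using permutes_in_image[OF \<tau>] that by blast
  have "(frob_norm n (\<lambda>i j. permute \<theta> \<tau> i j - \<theta> i j))\<^sup>2
      = (\<Sum>i\<in>{1..n}. \<Sum>j\<in>{1..n}. (\<theta> (\<tau> i) (\<tau> j) - \<theta> i j)\<^sup>2)"
    unfolding frob_norm_sq by (simp add: frob_inner_def permute_def power2_eq_square)
  also have "\<dots> \<le> (\<Sum>i\<in>{1..n}. \<Sum>j\<in>{1..n}.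
      \<bar>\<theta> (\<tau> i) (\<tau> j) - \<theta> i (\<tau> j)\<bar> + \<bar>\<theta> i (\<tau> j) - \<theta> i j\<bar>)"
  proof (intro sum_mono)
    fix i j
    let ?u = "\<theta> (\<tau> i) (\<tau> j) - \<theta> i j"
    have "\<bar>?u\<bar> \<le> 1"
      using ordered_params_bounds[OF \<theta>, of i j] ordered_params_bounds[OF \<theta>, of "\<tau> i" "\<tau> j"] by simp
    hence "?u\<^sup>2 \<le> \<bar>?u\<bar>"
      using mult_left_le[of "\<bar>?u\<bar>" "\<bar>?u\<bar>"] by (simp add: power2_eq_square)
    thus "?u\<^sup>2 \<le> \<bar>\<theta> (\<tau> i) (\<tau> j) - \<theta> i (\<tau> j)\<bar> + \<bar>\<theta> i (\<tau> j) - \<theta> i j\<bar>" by linarith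
  qed
  also have "\<dots> = (\<Sum>i\<in>{1..n}. \<Sum>j\<in>{1..n}. \<bar>\<theta> (\<tau> i) (\<tau> j) - \<theta> i (\<tau> j)\<bar>)
      + (\<Sum>j\<in>{1..n}. \<Sum>i\<in>{1..n}. \<bar>\<theta> i (\<tau> j) - \<theta> i j\<bar>)"
    by (simp add: sum.distrib) (rule sum.swap)
  also have "\<dots> \<le> (\<Sum>i\<in>{1..n}. d + 2) + (\<Sum>j\<in>{1..n}. d + 4)"
  proof (intro add_mono sum_mono)
    fix i assume i: "i \<in> {1..n}"
    have "(\<Sum>j\<in>{1..n}. \<bar>\<theta> (\<tau> i) (\<tau> j) - \<theta> i (\<tau> j)\<bar>) = (\<Sum>j\<in>{1..n}. \<bar>\<theta> (\<tau> i) j - \<theta> i j\<bar>)"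
      using sum.permute[OF \<tau>, of "\<lambda>j. \<bar>\<theta> (\<tau> i) j - \<theta> i j\<bar>"] by (simp add: comp_def)
    thus "(\<Sum>j\<in>{1..n}. \<bar>\<theta> (\<tau> i) (\<tau> j) - \<theta> i (\<tau> j)\<bar>) \<le> d + 2"
      using row_distance_le[OF \<theta> \<tau>_in[OF i] i] d[OF i] by simp
    show "(\<Sum>k\<in>{1..n}. \<bar>\<theta> k (\<tau> i) - \<theta> k i\<bar>) \<le> d + 4"
      using column_distance_le[OF \<theta> \<tau>_in[OF i] i] d[OF i] by simp
  qed
  finally show ?thesis by (simp add: algebra_simps)
qed

section \<open>Stability of sorting under perturbation\<close>

text \<open>Pigeonhole: the \<open>i\<close> elements of \<open>{1..i}\<close> do not fit
  injectively into the \<open>i - 1\<close> values below \<open>i\<close>.\<close>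

lemma permutes_exceeds:
  fixes i n :: nat
  assumes \<tau>: "\<tau> permutes {1..n}" and i: "i \<in> {1..n}"
  obtains l where "l \<in> {1..i}" "i \<le> \<tau> l"
proof -
  have "\<not> \<tau> ` {1..i} \<subseteq> {1..<i}"
  proof
    assume "\<tau> ` {1..i} \<subseteq> {1..<i}"
    hence "card (\<tau> ` {1..i}) \<le> card {1..<i}" by (intro card_mono) auto
    moreover have "card (\<tau> ` {1..i}) = i"
      using permutes_inj_on[OF \<tau>] by (simp add: card_image)
    ultimately show False using i by auto
  qed
  then obtain l where l: "l \<in> {1..i}" "\<tau> l \<notin> {1..<i}" by blast
  moreover have "\<tau> l \<in> {1..n}" using permutes_in_image[OF \<tau>] l i by force
  ultimately show ?thesis using that by force
qed

lemma permutes_undercuts: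
  fixes i n :: nat
  assumes \<tau>: "\<tau> permutes {1..n}" and i: "i \<in> {1..n}"
  obtains l where "l \<in> {i..n}" "\<tau> l \<le> i"
proof -
  have "\<not> \<tau> ` {i..n} \<subseteq> {i<..n}"
  proof
    assume "\<tau> ` {i..n} \<subseteq> {i<..n}"
    hence "card (\<tau> ` {i..n}) \<le> card {i<..n}" by (intro card_mono) auto
    moreover have "card (\<tau> ` {i..n}) = Suc n - i"
      using permutes_inj_on[OF \<tau>] by (simp add: card_image)
    ultimately show False using i by auto
  qed
  then obtain l where l: "l \<in> {i..n}" "\<tau> l \<notin> {i<..n}" by blast
  moreover have "\<tau> l \<in> {1..n}" using permutes_in_image[OF \<tau>] l i by force
  ultimately show ?thesis using that by force
qed

text \<open>Counting gives \<open>k \<le> i\<close> with \<open>i \<le> \<tau> k\<close>, so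
  \<open>R i \<le> R (\<tau> k) \<le> r k + \<delta> \<le> r i + \<delta> \<le> R (\<tau> i) + 2 *
  \<delta>\<close>; the index \<open>l\<close> gives the reverse inequality. In the application
  \<open>r\<close> are the sorted noisy row sums and \<open>R\<close> the ordered true ones,
  affinely rescaled.\<close>

lemma sorting_stable:
  fixes R r :: "nat \<Rightarrow> real"
  assumes mono: "\<And>i j. i \<in> {1..n} \<Longrightarrow> j \<in> {1..n} \<Longrightarrow> i \<le> j \<Longrightarrow> R i \<le> R j"
    and sorted: "\<And>i j. i \<in> {1..n} \<Longrightarrow> j \<in> {1..n} \<Longrightarrow> i \<le> j \<Longrightarrow> r i \<le> r j"
    and \<tau>: "\<tau> permutes {1..n}"
    and close: "\<And>i. i \<in> {1..n} \<Longrightarrow> \<bar>r i - R (\<tau> i)\<bar> \<le> \<delta>"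
    and i: "i \<in> {1..n}"
  shows "\<bar>R (\<tau> i) - R i\<bar> \<le> 2 * \<delta>"
proof -
  have \<tau>_in: "\<tau> k \<in> {1..n}" if "k \<in> {1..n}" for k
    using permutes_in_image[OF \<tau>] that by blast
  obtain k where k: "k \<in> {1..i}" "i \<le> \<tau> k" using permutes_exceeds[OF \<tau> i] .
  obtain l where l: "l \<in> {i..n}" "\<tau> l \<le> i" using permutes_undercuts[OF \<tau> i] .
  have kl: "k \<in> {1..n}" "l \<in> {1..n}" using k l i by auto
  have "R i \<le> R (\<tau> k)" "R (\<tau> l) \<le> R i" "r k \<le> r i" "r i \<le> r l"
    using mono[OF i \<tau>_in[OF kl(1)] k(2)] mono[OF \<tau>_in[OF kl(2)] i l(2)]
      sorted[OF kl(1) i] sorted[OF i kl(2)] k l by auto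
  thus ?thesis using close[OF kl(1)] close[OF kl(2)] close[OF i] by linarith
qed

section \<open>Linear functionals on monotone columns\<close>

text \<open>Abel summation writes the sum as a combination of tail sums with the increments of
  \<open>a\<close> as nonnegative weights, of total mass at most 1. The index \<open>n + 1\<close>
  supplies the empty tail, whose value 0 absorbs the missing mass.\<close>

lemma sum_mult_mono_le_tail:
  fixes e a :: "nat \<Rightarrow> real"
  assumes mono: "\<And>i k. 1 \<le> i \<Longrightarrow> i \<le> k \<Longrightarrow> k \<le> n \<Longrightarrow> a i \<le> a k"
    and bounds: "\<And>i. i \<in> {1..n} \<Longrightarrow> 0 \<le> a i \<and> a i \<le> 1"
  shows "\<exists>k\<in>{1..n+1}. (\<Sum>i\<in>{1..n}. e i * a i) \<le> (\<Sum>i\<in>{k..n}. e i)"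
proof -
  define T where "T k = (\<Sum>i\<in>{k..n}. e i)" for k
  define M where "M = Max (T ` {1..n+1})"
  have M: "T k \<le> M" if "k \<in> {1..n+1}" for k
    unfolding M_def using that by (intro Max_ge) auto
  have M0: "0 \<le> M" using M[of "n+1"] by (simp add: T_def)
  define a' where "a' i = (if i = 0 then 0 else a i)" for i
  \<comment> \<open>The left side is the full sum with every coefficient beyond \<open>m\<close>
    replaced by \<open>a' m\<close>; the induction step raises them to
    \<open>a' (Suc m)\<close>.\<close>
  have "(\<Sum>i\<in>{1..m}. e i * a i) + a' m * T (Suc m) \<le> a' m * M" if "m \<le> n" for m
    using that
  proof (induction m)
    case 0
    show ?case by (simp add: a'_def)
  next
    case (Suc m)
    have inc: "a' m \<le> a' (Suc m)"
      using mono[of m "Suc m"] bounds[of "Suc m"] Suc.prems by (auto simp: a'_def)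
    have T: "T (Suc m) = e (Suc m) + T (Suc (Suc m))"
      unfolding T_def using Suc.prems by (subst sum.atLeast_Suc_atMost) auto
    have "(a' (Suc m) - a' m) * T (Suc m) \<le> (a' (Suc m) - a' m) * M"
      using M[of "Suc m"] Suc.prems inc by (intro mult_left_mono) auto
    hence "(\<Sum>i\<in>{1..m}. e i * a i) + e (Suc m) * a' (Suc m) + a' (Suc m) * T (Suc (Suc m))
        \<le> a' (Suc m) * M"
      using Suc.IH Suc.prems T by (simp add: algebra_simps)
    moreover have "(\<Sum>i\<in>{1..Suc m}. e i * a i) = (\<Sum>i\<in>{1..m}. e i * a i) + e (Suc m) * a' (Suc m)"
      by (simp add: a'_def)
    ultimately show ?case by (simp only:)
  qed
  from this[of n] have "(\<Sum>i\<in>{1..n}. e i * a i) \<le> a' n * M" by (simp add: T_def)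
  also have "\<dots> \<le> M" using bounds[of n] M0 by (cases "n = 0") (auto simp: a'_def mult_left_le_one_le)
  finally have "(\<Sum>i\<in>{1..n}. e i * a i) \<le> M" .
  moreover have "M \<in> T ` {1..n+1}" unfolding M_def by (intro Max_in) auto
  ultimately show ?thesis by (auto simp: T_def)
qed

lemma column_inner_le_tail:
  assumes A: "A \<in> ordered_params m n" and j: "j \<in> {1..n}" and ej: "e j = 0"
  shows "\<exists>k\<in>{1..n+1}. (\<Sum>i\<in>{1..n}. e i * A i j) \<le> (\<Sum>i\<in>{k..n}. e i :: real)"
proof -
  \<comment> \<open>The zero diagonal entry would break the monotonicity of the column, so it is
    replaced by its neighbour above; since \<open>e j = 0\<close>, the sum does not change.\<close>
  define a where "a i = (if i = j then (if j = 1 then 0 else A (j - 1) j) else A i j)" for i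
  have "\<exists>k\<in>{1..n+1}. (\<Sum>i\<in>{1..n}. e i * a i) \<le> (\<Sum>i\<in>{k..n}. e i)"
  proof (rule sum_mult_mono_le_tail)
    fix i show "0 \<le> a i \<and> a i \<le> 1"
      using ordered_params_bounds[OF A] by (auto simp: a_def)
  next
    fix i k assume ik: "1 \<le> i" "i \<le> k" "k \<le> n"
    have col: "A s j \<le> A t j" if "1 \<le> s" "s \<le> t" "t \<le> n" "s \<noteq> j" "t \<noteq> j" for s t
      using ordered_params_column_mono[OF A, of s t j] that j by (cases "s = t") auto
    consider "i = k" | "i \<noteq> k" "i = j" | "i \<noteq> k" "k = j" | "i \<noteq> j" "k \<noteq> j" by blast
    thus "a i \<le> a k"
    proof cases
      case 2
      thus ?thesis using col[of "j - 1" k] ik ordered_params_bounds[OF A, of k j]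
        by (auto simp: a_def)
    next
      case 3
      thus ?thesis using col[of i "j - 1"] ik by (auto simp: a_def)
    next
      case 4
      thus ?thesis using col[of i k] ik by (simp add: a_def)
    qed simp
  qed
  moreover have "(\<Sum>i\<in>{1..n}. e i * a i) = (\<Sum>i\<in>{1..n}. e i * A i j)"
    using ej by (intro sum.cong) (auto simp: a_def)
  ultimately show ?thesis by simp
qed

text \<open>After relabelling by \<open>\<sigma>\<close>, column \<open>j\<close> is
  \<open>s\<close> times the indicator of \<open>k j \<le> i\<close>. Carrying
  \<open>\<sigma>\<close> in the index covers permutations chosen from the data; both signs occur
  because the contributions of \<open>P\<close> and \<open>- t\<close> are bounded
  separately.\<close>

definition signed_threshold :: "nat \<Rightarrow> real \<times> (nat \<Rightarrow> nat) \<times> (nat \<Rightarrow> nat) \<Rightarrow> mat" where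
  "signed_threshold n = (\<lambda>(s, \<sigma>, k) i j. s * of_bool (k (inv \<sigma> j) \<le> inv \<sigma> i))"

definition signed_thresholds :: "nat \<Rightarrow> mat set" where
  "signed_thresholds n = signed_threshold n `
     ({1, -1} \<times> {\<sigma>. \<sigma> permutes {1..n}} \<times> ({1..n} \<rightarrow>\<^sub>E {1..n+1}))"

lemma finite_signed_thresholds: "finite (signed_thresholds n)"
  unfolding signed_thresholds_def
  by (intro finite_imageI finite_cartesian_product finite_permutations finite_PiE) auto

lemma signed_thresholds_nonempty: "signed_thresholds n \<noteq> {}"
proof -
  have "id permutes {1..n}" by (rule permutes_id)
  moreover have "(\<lambda>i\<in>{1..n}. 1) \<in> {1..n} \<rightarrow>\<^sub>E {1..n+1}" by auto
  ultimately show ?thesis unfolding signed_thresholds_def by blast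
qed

lemma card_signed_thresholds_le: "card (signed_thresholds n) \<le> 2 * fact n * (n + 1) ^ n"
proof -
  have "card (signed_thresholds n)
      \<le> card ({1, -1 :: real} \<times> {\<sigma>. \<sigma> permutes {1..n}} \<times> ({1..n} \<rightarrow>\<^sub>E {1..n+1}))"
    unfolding signed_thresholds_def
    by (intro card_image_le finite_cartesian_product finite_permutations finite_PiE) auto
  also have "\<dots> = 2 * fact n * (n + 1) ^ n"
    using card_permutations[of "{1..n}" n] by (simp add: card_cartesian_product card_PiE)
  finally show ?thesis .
qed

lemma signed_thresholds_abs_le: "B \<in> signed_thresholds n \<Longrightarrow> \<bar>B i j\<bar> \<le> 1"
  by (auto simp: signed_thresholds_def signed_threshold_def)

text \<open>Linear functionals on \<open>[0,1]\<close>-valued monotone columns are maximal at indicators of tails.\<close>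

lemma inner_ordered_le_signed_threshold:
  assumes A: "A \<in> ordered_params m n" and \<sigma>: "\<sigma> permutes {1..n}"
    and diag: "\<And>i. X i i = 0" and s: "s \<in> {1, -1}"
  shows "\<exists>B\<in>signed_thresholds n. s * frob_inner n (permute X \<sigma>) A \<le> frob_inner n X B"
proof -
  have "\<forall>j\<in>{1..n}. \<exists>k. k \<in> {1..n+1} \<and>
      (\<Sum>i\<in>{1..n}. s * X (\<sigma> i) (\<sigma> j) * A i j) \<le> (\<Sum>i\<in>{k..n}. s * X (\<sigma> i) (\<sigma> j))"
    using column_inner_le_tail[OF A, where e = "\<lambda>i. s * X (\<sigma> i) (\<sigma> j)" for j]
    by (simp add: diag Bex_def)
  from bchoice[OF this] obtain k0 where k0: "\<And>j. j \<in> {1..n} \<Longrightarrow> k0 j \<in> {1..n+1}"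
    "\<And>j. j \<in> {1..n} \<Longrightarrow>
      (\<Sum>i\<in>{1..n}. s * X (\<sigma> i) (\<sigma> j) * A i j) \<le> (\<Sum>i\<in>{k0 j..n}. s * X (\<sigma> i) (\<sigma> j))"
    by blast
  \<comment> \<open>Restriction makes the choice of thresholds extensional, hence a member of the
    finite index set.\<close>
  define k where "k = restrict k0 {1..n}"
  define B where "B = signed_threshold n (s, \<sigma>, k)"
  have "k \<in> {1..n} \<rightarrow>\<^sub>E {1..n+1}" using k0(1) by (auto simp: k_def)
  hence B: "B \<in> signed_thresholds n"
    using s \<sigma> unfolding B_def signed_thresholds_def by blast
  have "s * frob_inner n (permute X \<sigma>) A
      = (\<Sum>j\<in>{1..n}. \<Sum>i\<in>{1..n}. s * X (\<sigma> i) (\<sigma> j) * A i j)"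
    unfolding frob_inner_def permute_def
    by (subst sum.swap) (simp add: sum_distrib_left mult.assoc)
  also have "\<dots> \<le> (\<Sum>j\<in>{1..n}. \<Sum>i\<in>{k0 j..n}. s * X (\<sigma> i) (\<sigma> j))"
    by (intro sum_mono k0(2))
  also have "\<dots> = (\<Sum>j\<in>{1..n}. \<Sum>i\<in>{1..n}. X (\<sigma> i) (\<sigma> j) * (s * of_bool (k j \<le> i)))"
  proof (rule sum.cong[OF refl])
    fix j assume j: "j \<in> {1..n}"
    have "(\<Sum>i\<in>{k0 j..n}. s * X (\<sigma> i) (\<sigma> j))
        = (\<Sum>i\<in>{k0 j..n}. X (\<sigma> i) (\<sigma> j) * (s * of_bool (k j \<le> i)))"
      using j by (intro sum.cong) (auto simp: k_def)
    also have "\<dots> = (\<Sum>i\<in>{1..n}. X (\<sigma> i) (\<sigma> j) * (s * of_bool (k j \<le> i)))"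
      using k0(1)[OF j] j by (intro sum.mono_neutral_left) (auto simp: k_def)
    finally show "(\<Sum>i\<in>{k0 j..n}. s * X (\<sigma> i) (\<sigma> j))
        = (\<Sum>i\<in>{1..n}. X (\<sigma> i) (\<sigma> j) * (s * of_bool (k j \<le> i)))" .
  qed
  also have "\<dots> = frob_inner n (permute X \<sigma>) (permute B \<sigma>)"
    unfolding frob_inner_def permute_def B_def signed_threshold_def
    by (subst sum.swap) (simp add: permutes_inverses[OF \<sigma>])
  also have "\<dots> = frob_inner n X B" by (rule frob_inner_permute[OF \<sigma>])
  finally show ?thesis using B by blast
qed

section \<open>Existence of projections and of sorting permutations\<close>

lemma continuous_on_entry: "continuous_on UNIV (\<lambda>\<theta>::mat. \<theta> i j)"
proof -
  have "continuous_on UNIV ((\<lambda>r::nat \<Rightarrow> real. r j) \<circ> (\<lambda>\<theta>::mat. \<theta> i))"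
    by (intro continuous_on_compose continuous_on_product_coordinates
        continuous_on_subset[OF continuous_on_product_coordinates]) auto
  thus ?thesis by (simp add: comp_def)
qed

text \<open>Matrices are functions on all pairs of naturals with the product topology, so this is
  Tychonoff's theorem, applied once within a row and once over the rows.\<close>

lemma compact_unit_box: "compact {\<theta>::mat. \<forall>i j. \<theta> i j \<in> {0..1}}"
proof -
  have "compactin (product_topology (\<lambda>_. euclidean) UNIV) (PiE UNIV (\<lambda>_::nat. {0..1::real}))"
    unfolding compactin_PiE by auto
  hence "compact (PiE UNIV (\<lambda>_::nat. {0..1::real}))"
    by (simp add: euclidean_product_topology)
  hence "compactin (product_topology (\<lambda>_. euclidean) UNIV)
      (PiE UNIV (\<lambda>_::nat. PiE UNIV (\<lambda>_::nat. {0..1::real})))"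
    unfolding compactin_PiE by auto
  hence "compact (PiE UNIV (\<lambda>_::nat. PiE UNIV (\<lambda>_::nat. {0..1::real})))"
    by (simp add: euclidean_product_topology)
  also have "PiE UNIV (\<lambda>_::nat. PiE UNIV (\<lambda>_::nat. {0..1::real})) = {\<theta>. \<forall>i j. \<theta> i j \<in> {0..1}}"
    by (auto simp: PiE_def Pi_def extensional_def)
  finally show ?thesis .
qed

lemma closed_ordered_params: "closed (ordered_params m n)"
proof (cases m)
  case Tournament
  have "closed (tournament_params n)"
    unfolding tournament_params_def unit_matrices_def matrices_def Ball_def atLeastAtMost_iff mem_Collect_eq
    by (intro closed_Collect_conj closed_Collect_all closed_Collect_imp open_Collect_const
        closed_Collect_le closed_Collect_eq continuous_on_entry continuous_intros)
  with Tournament show ?thesis by simp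
next
  case Graph
  have "closed (graph_params n)"
    unfolding graph_params_def unit_matrices_def matrices_def Ball_def atLeastAtMost_iff mem_Collect_eq
    by (intro closed_Collect_conj closed_Collect_all closed_Collect_imp open_Collect_const
        closed_Collect_le closed_Collect_eq continuous_on_entry continuous_intros)
  with Graph show ?thesis by simp
qed

lemma compact_ordered_params: "compact (ordered_params m n)"
proof -
  have "ordered_params m n = {\<theta>. \<forall>i j. \<theta> i j \<in> {0..1}} \<inter> ordered_params m n"
    using ordered_params_bounds by auto
  thus ?thesis
    using compact_Int_closed[OF compact_unit_box closed_ordered_params, of m n] by simp
qed

text \<open>\<open>arg_min_on\<close> is a choice operator and says something only if a minimiser
  exists; compactness provides one, and \<open>t\<close> shows that the set is nonempty.\<close>

lemma proj_ordered_params: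
  assumes "t \<in> ordered_params m n"
  shows "proj n (ordered_params m n) A \<in> ordered_params m n \<and>
    (\<forall>B\<in>ordered_params m n. frob_norm n (\<lambda>i j. A i j - proj n (ordered_params m n) A i j)
      \<le> frob_norm n (\<lambda>i j. A i j - B i j))"
proof -
  have "continuous_on UNIV (\<lambda>B::mat. frob_norm n (\<lambda>i j. A i j - B i j))"
    unfolding frob_norm_def by (intro continuous_intros continuous_on_entry)
  hence "continuous_on (ordered_params m n) (\<lambda>B. frob_norm n (\<lambda>i j. A i j - B i j))"
    by (rule continuous_on_subset) simp
  then obtain P where P: "P \<in> ordered_params m n"
    "\<And>B. B \<in> ordered_params m n \<Longrightarrow> frob_norm n (\<lambda>i j. A i j - P i j) \<le> frob_norm n (\<lambda>i j. A i j - B i j)"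
    using continuous_attains_inf[OF compact_ordered_params, of m n "\<lambda>B. frob_norm n (\<lambda>i j. A i j - B i j)"] assms
    by blast
  show ?thesis unfolding proj_def arg_min_on_def
    by (rule arg_minI[of _ P]) (use P in \<open>auto simp: not_less\<close>)
qed

text \<open>Needed for \<open>pmf_of_set\<close> to be the uniform law. The witness reads off the
  list of sorted row indices, shifted by one because lists are indexed from 0.\<close>

lemma sorting_perms_nonempty: "sorting_perms n y \<noteq> {}"
proof -
  define xs where "xs = sort_key (row_sum n y) [1..<Suc n]"
  have len: "length xs = n" by (simp add: xs_def)
  have dist: "distinct xs" by (simp add: xs_def)
  have set: "set xs = {1..n}" by (auto simp: xs_def)
  have sorted: "sorted (map (row_sum n y) xs)" by (simp add: xs_def)
  define \<sigma> where "\<sigma> i = (if i \<in> {1..n} then xs ! (i - 1) else i)" for i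
  have "bij_betw (\<lambda>i. i - 1) {1..n} {..<length xs}"
    by (rule bij_betw_byWitness[where f' = Suc]) (auto simp: len)
  hence "bij_betw ((\<lambda>i. xs ! i) \<circ> (\<lambda>i. i - 1)) {1..n} {1..n}"
    using bij_betw_nth[OF dist refl set[symmetric]] by (rule bij_betw_trans)
  hence "bij_betw \<sigma> {1..n} {1..n}"
    by (rule bij_betw_cong[THEN iffD1, rotated]) (simp add: \<sigma>_def)
  hence "\<sigma> permutes {1..n}"
    by (rule bij_imp_permutes) (auto simp: \<sigma>_def)
  moreover have "row_sum n y (\<sigma> i) \<le> row_sum n y (\<sigma> j)" if "i \<in> {1..n}" "j \<in> {1..n}" "i \<le> j" for i j
    using sorted_nth_mono[OF sorted, of "i - 1" "j - 1"] that len by (auto simp: \<sigma>_def)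
  ultimately have "\<sigma> \<in> sorting_perms n y" by (simp add: sorting_perms_def)
  thus ?thesis by blast
qed

lemma finite_sorting_perms: "finite (sorting_perms n y)"
  by (rule finite_subset[OF _ finite_permutations[of "{1..n}"]]) (auto simp: sorting_perms_def)

section \<open>The loss for fixed data\<close>

text \<open>The centred data: a missing entry has the value 1/2, so off the diagonal
  \<open>y - J / 2\<close> has mean \<open>p * (\<theta> - J / 2)\<close>.\<close>

definition noise ::
    "model \<Rightarrow> nat \<Rightarrow> real \<Rightarrow> mat \<Rightarrow> (nat \<times> nat \<Rightarrow> bool) \<Rightarrow> (nat \<times> nat \<Rightarrow> bool) \<Rightarrow> mat" where
  "noise m n p \<theta> Z D = (\<lambda>i j. data_matrix m n Z D i j - J n i j / 2 - p * (\<theta> i j - J n i j / 2))"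

definition entry_noise :: "real \<Rightarrow> real \<Rightarrow> bool \<Rightarrow> bool \<Rightarrow> real" where
  "entry_noise p t z d = (if d then of_bool z - 1 / 2 else 0) - p * (t - 1 / 2)"

lemma Theta_bounds:
  assumes "\<theta> \<in> Theta m n"
  shows "0 \<le> \<theta> i j" "\<theta> i j \<le> 1"
  using assms by (auto simp: Theta_def permute_def ordered_params_bounds)

lemma Theta_diag:
  assumes "\<theta> \<in> Theta m n"
  shows "\<theta> i i = 0"
  using assms by (auto simp: Theta_def permute_def ordered_params_diag)

lemma Theta_flip:
  assumes "\<theta> \<in> Theta m n" "i \<in> {1..n}" "j \<in> {1..n}" "i \<noteq> j"
  shows "\<theta> j i - 1 / 2 = model_sign m * (\<theta> i j - 1 / 2)"
proof -
  from assms(1) obtain \<theta>0 \<pi> where *: "\<theta> = permute \<theta>0 \<pi>" "\<theta>0 \<in> ordered_params m n" "\<pi> permutes {1..n}"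
    unfolding Theta_def by blast
  have "\<pi> i \<in> {1..n}" "\<pi> j \<in> {1..n}" "\<pi> i \<noteq> \<pi> j"
    using permutes_in_image[OF *(3)] permutes_inj[OF *(3)] assms by (auto simp: inj_eq)
  thus ?thesis using ordered_params_flip[OF *(2), of "\<pi> i" "\<pi> j"] by (simp add: *(1) permute_def)
qed

lemma noise_diag:
  assumes "\<theta> \<in> Theta m n"
  shows "noise m n p \<theta> Z D i i = 0"
  using Theta_diag[OF assms] by (simp add: noise_def data_matrix_def J_def upper_def)

lemma noise_upper:
  assumes "(i, j) \<in> upper n"
  shows "noise m n p \<theta> Z D i j = entry_noise p (\<theta> i j) (Z (i, j)) (D (i, j))"
  using assms
  by (auto simp: noise_def data_matrix_def J_def upper_def upper_datum_def entry_noise_def)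

lemma noise_lower:
  assumes \<theta>: "\<theta> \<in> Theta m n" and ij: "(i, j) \<in> upper n"
  shows "noise m n p \<theta> Z D j i = model_sign m * entry_noise p (\<theta> i j) (Z (i, j)) (D (i, j))"
proof -
  have ij': "i \<in> {1..n}" "j \<in> {1..n}" "i \<noteq> j" "(j, i) \<notin> upper n" using ij by (auto simp: upper_def)
  have y: "data_matrix m n Z D j i - 1 / 2 = model_sign m * (upper_datum Z D (i, j) - 1 / 2)"
    using ij ij'(4) by (cases m) (simp_all add: data_matrix_def)
  have "noise m n p \<theta> Z D j i = (data_matrix m n Z D j i - 1 / 2) - p * (\<theta> j i - 1 / 2)"
    using ij' by (simp add: noise_def J_def)
  also have "\<dots> = model_sign m * (upper_datum Z D (i, j) - 1 / 2) - p * (model_sign m * (\<theta> i j - 1 / 2))"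
    by (simp only: y Theta_flip[OF \<theta> ij'(1-3)])
  also have "\<dots> = model_sign m * ((upper_datum Z D (i, j) - 1 / 2) - p * (\<theta> i j - 1 / 2))"
    by (simp add: algebra_simps)
  finally show ?thesis by (simp add: entry_noise_def upper_datum_def)
qed

lemma finite_upper: "finite (upper n)"
  by (rule finite_subset[of _ "{1..n} \<times> {1..n}"]) (auto simp: upper_def)

lemma card_upper: "card (upper n) = n choose 2"
proof -
  have "upper n = (SIGMA i:{1..n}. {i<..n})" by (auto simp: upper_def)
  hence "card (upper n) = (\<Sum>i\<in>{1..n}. n - i)" by simp
  also have "\<dots> = (\<Sum>i\<in>{0..<n}. i)"
    by (rule sum.reindex_bij_witness[of _ "\<lambda>i. n - i" "\<lambda>i. n - i"]) auto
  also have "\<dots> = n choose 2" by (simp add: gauss_sum_nat choose_two Sum_Ico_nat mult.commute)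
  finally show ?thesis .
qed

lemma sum_off_diagonal:
  fixes f :: "nat \<Rightarrow> nat \<Rightarrow> real"
  assumes "\<And>i. i \<in> {1..n} \<Longrightarrow> f i i = 0"
  shows "(\<Sum>i\<in>{1..n}. \<Sum>j\<in>{1..n}. f i j) = (\<Sum>(i, j)\<in>upper n. f i j + f j i)"
proof -
  have "(\<Sum>i\<in>{1..n}. \<Sum>j\<in>{1..n}. f i j) = (\<Sum>(i, j)\<in>{1..n} \<times> {1..n}. f i j)"
    by (simp add: sum.cartesian_product)
  also have "\<dots> = (\<Sum>(i, j)\<in>upper n \<union> prod.swap ` upper n. f i j)"
  proof (intro sum.mono_neutral_right ballI)
    fix e assume "e \<in> {1..n} \<times> {1..n} - (upper n \<union> prod.swap ` upper n)"
    hence "fst e = snd e" "fst e \<in> {1..n}" by (force simp: upper_def image_iff)+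
    thus "(case e of (i, j) \<Rightarrow> f i j) = 0" using assms by (cases e) simp
  qed (auto simp: upper_def)
  also have "\<dots> = (\<Sum>(i, j)\<in>upper n. f i j) + (\<Sum>(i, j)\<in>prod.swap ` upper n. f i j)"
    by (intro sum.union_disjoint finite_imageI finite_upper) (auto simp: upper_def)
  also have "(\<Sum>(i, j)\<in>prod.swap ` upper n. f i j) = (\<Sum>(i, j)\<in>upper n. f j i)"
    by (subst sum.reindex) (auto simp: case_prod_unfold)
  finally show ?thesis by (simp add: sum.distrib case_prod_unfold)
qed

lemma frob_inner_noise:
  assumes "\<theta> \<in> Theta m n"
  shows "frob_inner n (noise m n p \<theta> Z D) B
    = (\<Sum>(i, j)\<in>upper n. (B i j + model_sign m * B j i) * entry_noise p (\<theta> i j) (Z (i, j)) (D (i, j)))"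
  unfolding frob_inner_def
  by (subst sum_off_diagonal)
     (auto simp: noise_diag[OF assms] noise_upper noise_lower[OF assms] algebra_simps intro!: sum.cong)

text \<open>Expanding the hypothesis around \<open>w\<close> bounds the squared distance of
  \<open>P\<close> and \<open>w\<close> by \<open>2 * \<langle>z - w, P - t\<rangle>\<close> plus
  the squared distance of \<open>w\<close> and \<open>t\<close>; the stated bound is twice this.
  Here \<open>w\<close> is the relabelled truth, which need not be ordered, and \<open>t\<close> is
  the ordered competitor.\<close>

lemma perturbed_projection_bound:
  assumes "(frob_norm n (\<lambda>i j. z i j - P i j))\<^sup>2 \<le> (frob_norm n (\<lambda>i j. z i j - t i j))\<^sup>2"
  shows "(frob_norm n (\<lambda>i j. P i j - w i j))\<^sup>2
    \<le> 4 * frob_inner n (\<lambda>i j. z i j - w i j) (\<lambda>i j. P i j - t i j)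
      + 2 * (frob_norm n (\<lambda>i j. w i j - t i j))\<^sup>2"
proof -
  have pt: "(P - w)\<^sup>2 + 2 * (z - t)\<^sup>2 \<le> 4 * ((z - w) * (P - t)) + 2 * (w - t)\<^sup>2 + 2 * (z - P)\<^sup>2" for P w z t :: real
  proof -
    have "4 * ((z - w) * (P - t)) + 2 * (w - t)\<^sup>2 + 2 * (z - P)\<^sup>2 - ((P - w)\<^sup>2 + 2 * (z - t)\<^sup>2)
      = ((P - t) - (w - t))\<^sup>2" by (simp add: power2_eq_square algebra_simps)
    thus ?thesis using zero_le_power2[of "(P - t) - (w - t)"] by linarith
  qed
  have "(\<Sum>i\<in>{1..n}. \<Sum>j\<in>{1..n}. (P i j - w i j)\<^sup>2 + 2 * (z i j - t i j)\<^sup>2)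
    \<le> (\<Sum>i\<in>{1..n}. \<Sum>j\<in>{1..n}. 4 * ((z i j - w i j) * (P i j - t i j)) + 2 * (w i j - t i j)\<^sup>2 + 2 * (z i j - P i j)\<^sup>2)"
    by (intro sum_mono pt)
  thus ?thesis using assms
    by (simp add: frob_norm_sq frob_inner_def sum.distrib flip: power2_eq_square sum_distrib_left)
qed

lemma frob_norm_sq_le:
  assumes "\<And>i j. \<bar>A i j\<bar> \<le> 1"
  shows "(frob_norm n A)\<^sup>2 \<le> (real n)\<^sup>2"
proof -
  have "A i j * A i j \<le> 1" for i j
    using assms[of i j] by (simp add: abs_square_le_1 flip: power2_eq_square)
  hence "frob_inner n A A \<le> (\<Sum>i\<in>{1..n}. \<Sum>j\<in>{1..n}. 1)"
    unfolding frob_inner_def by (intro sum_mono)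
  thus ?thesis unfolding frob_norm_sq by (simp add: power2_eq_square)
qed

text \<open>Both branches of the estimator have entries in [0,1]. This crude bound serves when
  \<open>p_hat\<close> is far below \<open>p\<close> and when \<open>n = 2\<close>.\<close>

lemma theta_hat_loss_le:
  assumes \<theta>: "\<theta> \<in> Theta m n"
  shows "(frob_norm n (\<lambda>i j. theta_hat m n y ph \<sigma> i j - \<theta> i j))\<^sup>2 \<le> (real n)\<^sup>2"
proof (rule frob_norm_sq_le)
  fix i j
  obtain t where t: "t \<in> ordered_params m n" using \<theta> by (auto simp: Theta_def)
  have "0 \<le> theta_hat m n y ph \<sigma> i j \<and> theta_hat m n y ph \<sigma> i j \<le> 1"
    using ordered_params_bounds[OF conjunct1[OF proj_ordered_params[OF t]]]
    by (simp add: theta_hat_def permute_def J_def)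
  thus "\<bar>theta_hat m n y ph \<sigma> i j - \<theta> i j\<bar> \<le> 1"
    using Theta_bounds[OF \<theta>, of i j] by linarith
qed

text \<open>The default value 1/2 shifts every row by the same amount
  \<open>(1 - p) * (n - 1) / 2\<close>, so up to noise the data order the rows as
  \<open>\<theta>\<close> does.\<close>

lemma row_sum_data:
  assumes "a \<in> {1..n}"
  shows "row_sum n (data_matrix m n Z D) a
    = row_sum n (noise m n p \<theta> Z D) a + (1 - p) * (real n - 1) / 2 + p * row_sum n \<theta> a"
proof -
  have "(\<Sum>j\<in>{1..n}. J n a j) = (\<Sum>j\<in>{1..n} - {a}. 1)"
    using assms by (subst sum.remove[of _ a]) (auto simp: J_def intro!: sum.cong)
  also have "\<dots> = real n - 1" using assms by (simp add: of_nat_diff)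
  finally have J: "(\<Sum>j\<in>{1..n}. J n a j) = real n - 1" .
  have "row_sum n (data_matrix m n Z D) a
      = (\<Sum>j\<in>{1..n}. noise m n p \<theta> Z D a j + (1 - p) / 2 * J n a j + p * \<theta> a j)"
    unfolding row_sum_def noise_def by (intro sum.cong refl) (simp add: field_simps)
  thus ?thesis unfolding sum.distrib sum_distrib_left[symmetric] J row_sum_def by simp
qed

lemma abs_minus_half_le:
  fixes t :: real
  assumes "0 \<le> t" "t \<le> 1"
  shows "\<bar>t - 1 / 2\<bar> \<le> 1 / 2"
  using assms by linarith

lemma theta_hat_loss_bound:
  assumes \<theta>: "\<theta> \<in> Theta m n"
    and \<sigma>: "\<sigma> \<in> sorting_perms n (data_matrix m n Z D)"
    and p: "0 < p" and ph: "p / 2 \<le> p_hat n D" "1 / real n \<le> p_hat n D"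
    and M: "\<And>B. B \<in> signed_thresholds n \<Longrightarrow> frob_inner n (noise m n p \<theta> Z D) B \<le> M"
    and \<delta>: "\<And>a. a \<in> {1..n} \<Longrightarrow> \<bar>row_sum n (noise m n p \<theta> Z D) a\<bar> \<le> \<delta>"
  shows "(frob_norm n (\<lambda>i j. theta_hat m n (data_matrix m n Z D) (p_hat n D) \<sigma> i j - \<theta> i j))\<^sup>2
    \<le> 16 * M / p + 4 * (real n)\<^sup>2 * (\<bar>p_hat n D - p\<bar> / p) + 2 * n * (4 * \<delta> / p + 6)"
proof -
  define \<xi> where "\<xi> = noise m n p \<theta> Z D"
  define y where "y = data_matrix m n Z D"
  define q where "q = p_hat n D"
  define z where "z = (\<lambda>i j. (y i j - J n i j / 2) / q + J n i j / 2)"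
  from \<theta> obtain t \<pi> where t: "\<theta> = permute t \<pi>" "t \<in> ordered_params m n" "\<pi> permutes {1..n}"
    unfolding Theta_def by blast
  define P where "P = proj n (ordered_params m n) (permute z \<sigma>)"
  have P: "P \<in> ordered_params m n"
    "frob_norm n (\<lambda>i j. permute z \<sigma> i j - P i j) \<le> frob_norm n (\<lambda>i j. permute z \<sigma> i j - t i j)"
    using proj_ordered_params[OF t(2), of "permute z \<sigma>"] t(2) unfolding P_def by blast+
  have \<sigma>_perm: "\<sigma> permutes {1..n}" using \<sigma> by (simp add: sorting_perms_def)
  define \<tau> where "\<tau> = \<pi> \<circ> \<sigma>"
  have \<tau>: "\<tau> permutes {1..n}" unfolding \<tau>_def by (rule permutes_compose[OF \<sigma>_perm t(3)])
  have w: "permute \<theta> \<sigma> = permute t \<tau>" by (simp add: t(1) permute_def \<tau>_def)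
  have q: "0 < q" "1 / q \<le> 2 / p" using p ph by (auto simp: q_def field_simps)
  have \<sigma>_in: "\<sigma> i \<in> {1..n}" if "i \<in> {1..n}" for i
    using permutes_in_image[OF \<sigma>_perm] that by blast

  \<comment> \<open>Stability of sorting is applied to the means of the data row sums, from which
    the noise deviates by at most \<open>\<delta>\<close>. The common shift cancels, and division by
    \<open>p\<close> gives \<open>2 * \<delta> / p\<close>.\<close>
  have "\<bar>(p * row_sum n t (\<tau> i) + (1 - p) * (real n - 1) / 2)
      - (p * row_sum n t i + (1 - p) * (real n - 1) / 2)\<bar> \<le> 2 * \<delta>" if "i \<in> {1..n}" for i
  proof (rule sorting_stable[where r = "\<lambda>i. row_sum n y (\<sigma> i)", OF _ _ \<tau> _ that])
    fix i j assume "i \<in> {1..n}" "j \<in> {1..n}" "i \<le> j"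
    thus "p * row_sum n t i + (1 - p) * (real n - 1) / 2 \<le> p * row_sum n t j + (1 - p) * (real n - 1) / 2"
      using row_sum_mono[OF t(2)] p by simp
    show "row_sum n y (\<sigma> i) \<le> row_sum n y (\<sigma> j)"
      using \<sigma> \<open>i \<in> {1..n}\<close> \<open>j \<in> {1..n}\<close> \<open>i \<le> j\<close> by (simp add: sorting_perms_def y_def)
  next
    fix i assume i: "i \<in> {1..n}"
    have "row_sum n \<theta> (\<sigma> i) = row_sum n t (\<tau> i)"
      using sum.permute[OF t(3), of "t (\<pi> (\<sigma> i))"]
      by (simp add: row_sum_def t(1) permute_def \<tau>_def comp_def)
    thus "\<bar>row_sum n y (\<sigma> i) - (p * row_sum n t (\<tau> i) + (1 - p) * (real n - 1) / 2)\<bar> \<le> \<delta>"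
      using row_sum_data[OF \<sigma>_in[OF i], of m Z D p \<theta>] \<delta>[OF \<sigma>_in[OF i]] by (simp add: y_def)
  qed
  hence "\<bar>p * (row_sum n t (\<tau> i) - row_sum n t i)\<bar> \<le> 2 * \<delta>" if "i \<in> {1..n}" for i
    using that by (simp add: right_diff_distrib)
  hence "\<bar>row_sum n t (\<tau> i) - row_sum n t i\<bar> \<le> 2 * \<delta> / p" if "i \<in> {1..n}" for i
    using that p by (simp add: abs_mult pos_le_divide_eq mult.commute)
  from permuted_ordered_distance_le[OF t(2) \<tau> this]
  have sort_error: "(frob_norm n (\<lambda>i j. permute \<theta> \<sigma> i j - t i j))\<^sup>2 \<le> n * (4 * \<delta> / p + 6)"
    by (simp add: w)

  have diag: "\<xi> i i = 0" for i unfolding \<xi>_def by (rule noise_diag[OF \<theta>])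
  have le_M: "s * frob_inner n (permute \<xi> \<sigma>) A \<le> M" if "A \<in> ordered_params m n" "s \<in> {1, -1}" for A s
    using inner_ordered_le_signed_threshold[OF that(1) \<sigma>_perm, of \<xi> s] diag that(2) M
    unfolding \<xi>_def by fastforce
  \<comment> \<open>The same functional with both signs is at most \<open>M\<close>, which forces
    \<open>M\<close> to be nonnegative.\<close>
  have M0: "0 \<le> M" using le_M[OF P(1), of 1] le_M[OF P(1), of "-1"] by simp
  have inner1: "frob_inner n (permute \<xi> \<sigma>) (\<lambda>i j. P i j - t i j) \<le> 2 * M"
    using le_M[OF P(1), of 1] le_M[OF t(2), of "-1"]
    by (simp add: frob_inner_def right_diff_distrib sum_subtractf)
  let ?S = "\<Sum>i\<in>{1..n}. \<Sum>j\<in>{1..n}. (\<theta> (\<sigma> i) (\<sigma> j) - J n (\<sigma> i) (\<sigma> j) / 2) * (P i j - t i j)"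
  have "\<bar>?S\<bar> \<le> (\<Sum>i\<in>{1..n}. \<Sum>j\<in>{1..n}. 1 / 2)"
  proof (intro order.trans[OF sum_abs] sum_mono)
    fix i j assume "i \<in> {1..n}" "j \<in> {1..n}"
    have "\<bar>\<theta> (\<sigma> i) (\<sigma> j) - J n (\<sigma> i) (\<sigma> j) / 2\<bar> \<le> 1 / 2"
    proof (cases "\<sigma> i = \<sigma> j")
      case True
      thus ?thesis using Theta_diag[OF \<theta>] by (simp add: J_def)
    next
      case False
      thus ?thesis
        using abs_minus_half_le[OF Theta_bounds[OF \<theta>, of "\<sigma> i" "\<sigma> j"]]
          \<sigma>_in[OF \<open>i \<in> {1..n}\<close>] \<sigma>_in[OF \<open>j \<in> {1..n}\<close>] by (simp add: J_def)
    qed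
    moreover have "\<bar>P i j - t i j\<bar> \<le> 1"
      using ordered_params_bounds[OF P(1), of i j] ordered_params_bounds[OF t(2), of i j] by linarith
    ultimately show "\<bar>(\<theta> (\<sigma> i) (\<sigma> j) - J n (\<sigma> i) (\<sigma> j) / 2) * (P i j - t i j)\<bar> \<le> 1 / 2"
      using mult_mono[of "\<bar>\<theta> (\<sigma> i) (\<sigma> j) - J n (\<sigma> i) (\<sigma> j) / 2\<bar>" "1 / 2" "\<bar>P i j - t i j\<bar>" 1]
      by (simp add: abs_mult)
  qed
  hence S: "\<bar>?S\<bar> \<le> (real n)\<^sup>2 / 2" by (simp add: power2_eq_square)
  \<comment> \<open>Before relabelling,
    \<open>z - \<theta> = \<xi> / q + (p / q - 1) * (\<theta> - J / 2)\<close>: noise plus the bias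
    from dividing by \<open>q\<close> instead of \<open>p\<close>.\<close>
  have "frob_inner n (\<lambda>i j. permute z \<sigma> i j - permute \<theta> \<sigma> i j) (\<lambda>i j. P i j - t i j)
      = (\<Sum>i\<in>{1..n}. \<Sum>j\<in>{1..n}. 1 / q * (permute \<xi> \<sigma> i j * (P i j - t i j))
        + (p / q - 1) * ((\<theta> (\<sigma> i) (\<sigma> j) - J n (\<sigma> i) (\<sigma> j) / 2) * (P i j - t i j)))"
    unfolding frob_inner_def permute_def z_def \<xi>_def noise_def y_def
    using q(1) by (intro sum.cong refl) (simp add: field_simps)
  also have "\<dots> = 1 / q * frob_inner n (permute \<xi> \<sigma>) (\<lambda>i j. P i j - t i j) + (p / q - 1) * ?S"
    unfolding frob_inner_def by (simp add: sum.distrib sum_distrib_left)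
  also have "\<dots> \<le> 2 / p * (2 * M) + (2 * \<bar>q - p\<bar> / p) * ((real n)\<^sup>2 / 2)"
  proof (rule add_mono)
    have "1 / q * frob_inner n (permute \<xi> \<sigma>) (\<lambda>i j. P i j - t i j) \<le> 1 / q * (2 * M)"
      using inner1 q(1) by (intro mult_left_mono) auto
    also have "\<dots> \<le> 2 / p * (2 * M)" using M0 q(2) by (intro mult_right_mono) auto
    finally show "1 / q * frob_inner n (permute \<xi> \<sigma>) (\<lambda>i j. P i j - t i j) \<le> 2 / p * (2 * M)" .
    have "\<bar>p / q - 1\<bar> = 1 / q * \<bar>q - p\<bar>" using q(1) by (simp add: field_simps abs_minus_commute)
    also have "\<dots> \<le> 2 / p * \<bar>q - p\<bar>" using q(2) by (intro mult_right_mono) auto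
    finally have "\<bar>p / q - 1\<bar> \<le> 2 * \<bar>q - p\<bar> / p" by simp
    hence "\<bar>p / q - 1\<bar> * \<bar>?S\<bar> \<le> (2 * \<bar>q - p\<bar> / p) * ((real n)\<^sup>2 / 2)"
      by (rule mult_mono[OF _ S _ abs_ge_zero]) (use p in simp)
    moreover have "(p / q - 1) * ?S \<le> \<bar>p / q - 1\<bar> * \<bar>?S\<bar>"
      unfolding abs_mult[symmetric] by (rule abs_ge_self)
    ultimately show "(p / q - 1) * ?S \<le> (2 * \<bar>q - p\<bar> / p) * ((real n)\<^sup>2 / 2)"
      by (rule order.trans[rotated])
  qed
  finally have inner: "frob_inner n (\<lambda>i j. permute z \<sigma> i j - permute \<theta> \<sigma> i j) (\<lambda>i j. P i j - t i j)
      \<le> 4 * M / p + \<bar>q - p\<bar> / p * (real n)\<^sup>2" by simp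

  have "permute (permute A (inv \<sigma>)) \<sigma> = A" for A
    by (simp add: permute_def permutes_inverses[OF \<sigma>_perm])
  \<comment> \<open>Relabelling by \<open>\<sigma>\<close> preserves the norm and moves the loss to
    the coordinates in which \<open>P\<close> is ordered.\<close>
  hence "(frob_norm n (\<lambda>i j. theta_hat m n y q \<sigma> i j - \<theta> i j))\<^sup>2
      = (frob_norm n (\<lambda>i j. P i j - permute \<theta> \<sigma> i j))\<^sup>2"
    using frob_inner_permute[OF \<sigma>_perm,
        of "\<lambda>i j. permute P (inv \<sigma>) i j - \<theta> i j" "\<lambda>i j. permute P (inv \<sigma>) i j - \<theta> i j"] ph(2)
    by (simp add: frob_norm_sq theta_hat_def q_def y_def P_def z_def permute_def
        permutes_inverses[OF \<sigma>_perm])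
  also have "\<dots> \<le> 4 * frob_inner n (\<lambda>i j. permute z \<sigma> i j - permute \<theta> \<sigma> i j) (\<lambda>i j. P i j - t i j)
      + 2 * (frob_norm n (\<lambda>i j. permute \<theta> \<sigma> i j - t i j))\<^sup>2"
    by (rule perturbed_projection_bound)
       (use P(2) in \<open>auto intro!: power_mono simp: frob_norm_def sum_nonneg\<close>)
  also have "\<dots> \<le> 4 * (4 * M / p + \<bar>q - p\<bar> / p * (real n)\<^sup>2) + 2 * (n * (4 * \<delta> / p + 6))"
    by (intro add_mono mult_left_mono inner sort_error) auto
  finally show ?thesis by (simp add: y_def q_def algebra_simps)
qed

section \<open>The risk\<close>

definition data_pmf ::
    "nat \<Rightarrow> real \<Rightarrow> mat \<Rightarrow> ((nat \<times> nat \<Rightarrow> bool) \<times> (nat \<times> nat \<Rightarrow> bool)) pmf" where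
  "data_pmf n p \<theta> = pair_pmf (Pi_pmf (upper n) False (\<lambda>(i, j). bernoulli_pmf (\<theta> i j)))
     (Pi_pmf (upper n) False (\<lambda>_. bernoulli_pmf p))"

lemma finite_set_data_pmf: "finite (set_pmf (data_pmf n p \<theta>))"
  by (simp add: data_pmf_def finite_set_Pi_pmf_bool finite_upper)

lemma estimator_pmf_conv_data_pmf:
  "estimator_pmf m n p \<theta> = data_pmf n p \<theta> \<bind> (\<lambda>(Z, D).
     map_pmf (theta_hat m n (data_matrix m n Z D) (p_hat n D))
       (pmf_of_set (sorting_perms n (data_matrix m n Z D))))"
  by (simp add: estimator_pmf_def data_pmf_def pair_pmf_def bind_assoc_pmf bind_return_pmf map_pmf_def)

text \<open>\<open>H\<close> bounds the loss for every permutation that sorts the data, so averaging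
  over ties keeps the bound and only the law of the data remains.\<close>

lemma risk_le_expectation:
  assumes H: "\<And>Z D \<sigma>. \<sigma> \<in> sorting_perms n (data_matrix m n Z D) \<Longrightarrow>
    (frob_norm n (\<lambda>i j. theta_hat m n (data_matrix m n Z D) (p_hat n D) \<sigma> i j - \<theta> i j))\<^sup>2 \<le> H (Z, D)"
  shows "risk m n p \<theta> \<le> measure_pmf.expectation (data_pmf n p \<theta>) H"
proof -
  let ?f = "\<lambda>t. (frob_norm n (\<lambda>i j. t i j - \<theta> i j))\<^sup>2"
  let ?S = "\<lambda>Z D. pmf_of_set (sorting_perms n (data_matrix m n Z D))"
  let ?N = "\<lambda>(Z, D). map_pmf (theta_hat m n (data_matrix m n Z D) (p_hat n D)) (?S Z D)"
  have S: "set_pmf (?S Z D) = sorting_perms n (data_matrix m n Z D)" for Z D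
    by (rule set_pmf_of_set[OF sorting_perms_nonempty finite_sorting_perms])
  hence fin: "finite (set_pmf (?S Z D))" for Z D by (simp add: finite_sorting_perms)
  have "risk m n p \<theta> = measure_pmf.expectation (data_pmf n p \<theta>) (\<lambda>x. measure_pmf.expectation (?N x) ?f)"
    unfolding risk_def estimator_pmf_conv_data_pmf
    by (rule expectation_bind_finite) (auto simp: finite_set_data_pmf fin split: prod.splits)
  also have "\<dots> \<le> measure_pmf.expectation (data_pmf n p \<theta>) H"
  proof (intro integral_mono integrable_measure_pmf_finite finite_set_data_pmf)
    fix x :: "(nat \<times> nat \<Rightarrow> bool) \<times> (nat \<times> nat \<Rightarrow> bool)"
    obtain Z D where x: "x = (Z, D)" by (cases x)
    have "measure_pmf.expectation (?S Z D)
        (\<lambda>\<sigma>. ?f (theta_hat m n (data_matrix m n Z D) (p_hat n D) \<sigma>)) \<le> H (Z, D)"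
      by (rule measure_pmf.integral_le_const)
         (auto intro!: integrable_measure_pmf_finite fin H simp: AE_measure_pmf_iff S)
    thus "measure_pmf.expectation (?N x) ?f \<le> H x" by (simp add: x)
  qed
  finally show ?thesis .
qed

lemma risk_le_trivial:
  assumes "\<theta> \<in> Theta m n"
  shows "risk m n p \<theta> \<le> (real n)\<^sup>2"
  using risk_le_expectation[of n m \<theta> "\<lambda>_. (real n)\<^sup>2" p] theta_hat_loss_le[OF assms] by simp

section \<open>Exponential moments of the noise and of the observation frequency\<close>

lemma abs_entry_noise_le:
  assumes "0 \<le> t" "t \<le> 1" "0 \<le> p" "p \<le> 1"
  shows "\<bar>entry_noise p t z d\<bar> \<le> 1"
proof -
  have "\<bar>p * (t - 1 / 2)\<bar> \<le> 1 * (1 / 2)"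
    unfolding abs_mult by (intro mult_mono abs_minus_half_le) (use assms in auto)
  thus ?thesis by (auto simp: entry_noise_def)
qed

lemma expectation_entry_noise:
  assumes "0 \<le> t" "t \<le> 1" "0 \<le> p" "p \<le> 1"
  shows "measure_pmf.expectation (pair_pmf (bernoulli_pmf t) (bernoulli_pmf p))
    (\<lambda>(z, d). entry_noise p t z d) = 0"
  using assms by (subst expectation_pair_finite) (simp_all add: entry_noise_def, simp add: field_simps)

lemma expectation_entry_noise_sq_le:
  assumes "0 \<le> t" "t \<le> 1" "0 \<le> p" "p \<le> 1"
  shows "measure_pmf.expectation (pair_pmf (bernoulli_pmf t) (bernoulli_pmf p))
    (\<lambda>(z, d). (entry_noise p t z d)\<^sup>2) \<le> p / 4"
proof -
  \<comment> \<open>An observed outcome is at distance exactly 1/2 from 1/2, so the uncentred second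
    moment is \<open>p / 4\<close>.\<close>
  have "measure_pmf.expectation (pair_pmf (bernoulli_pmf t) (bernoulli_pmf p))
    (\<lambda>(z, d). (entry_noise p t z d)\<^sup>2) = p / 4 - (p * (t - 1 / 2))\<^sup>2"
    using assms
    by (subst expectation_pair_finite)
       (simp_all add: entry_noise_def power2_eq_square, simp add: field_simps)
  thus ?thesis by simp
qed

text \<open>Each variable above the diagonal also appears below it, up to sign, so its coefficient
  is \<open>B i j\<close> plus or minus \<open>B j i\<close>. This is at most 2 in absolute value,
  whence \<open>l \<le> 1 / 2\<close>, and its square is at most twice the sum of the two squares,
  which turns the variance \<open>p / 4\<close> into the factor \<open>p / 2\<close>.\<close>

lemma noise_mgf_le:
  assumes \<theta>: "\<theta> \<in> Theta m n" and p: "0 \<le> p" "p \<le> 1" and l: "0 < l" "l \<le> 1 / 2"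
    and B: "\<And>i j. \<bar>B i j\<bar> \<le> 1"
  shows "measure_pmf.expectation (data_pmf n p \<theta>)
    (\<lambda>(Z, D). exp (l * frob_inner n (noise m n p \<theta> Z D) B)) \<le> exp (l\<^sup>2 * p / 2 * frob_inner n B B)"
proof -
  define c where "c e = B (fst e) (snd e) + model_sign m * B (snd e) (fst e)" for e
  define t where "t e = \<theta> (fst e) (snd e)" for e
  define h where "h e z d = l * c e * entry_noise p (t e) z d" for e z d
  have t: "0 \<le> t e" "t e \<le> 1" for e using Theta_bounds[OF \<theta>] by (auto simp: t_def)
  have c: "\<bar>c e\<bar> \<le> 2" "(c e)\<^sup>2 \<le> 2 * ((B (fst e) (snd e))\<^sup>2 + (B (snd e) (fst e))\<^sup>2)" for e
  proof -
    let ?a = "B (fst e) (snd e)" and ?b = "B (snd e) (fst e)"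
    show "\<bar>c e\<bar> \<le> 2" using B[of "fst e" "snd e"] B[of "snd e" "fst e"]
      by (cases m) (auto simp: c_def)
    have "0 \<le> (?a - ?b)\<^sup>2" "0 \<le> (?a + ?b)\<^sup>2" by simp_all
    thus "(c e)\<^sup>2 \<le> 2 * (?a\<^sup>2 + ?b\<^sup>2)"
      by (cases m) (simp_all add: c_def power2_eq_square algebra_simps)
  qed
  have "frob_inner n (noise m n p \<theta> Z D) B * l = (\<Sum>e\<in>upper n. h e (Z e) (D e))" for Z D
    unfolding frob_inner_noise[OF \<theta>] sum_distrib_right
    by (intro sum.cong) (auto simp: h_def c_def t_def)
  hence "measure_pmf.expectation (data_pmf n p \<theta>)
      (\<lambda>(Z, D). exp (l * frob_inner n (noise m n p \<theta> Z D) B))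
    = measure_pmf.expectation (pair_pmf (Pi_pmf (upper n) False (\<lambda>e. bernoulli_pmf (t e)))
        (Pi_pmf (upper n) False (\<lambda>_. bernoulli_pmf p))) (\<lambda>(Z, D). exp (\<Sum>e\<in>upper n. h e (Z e) (D e)))"
    by (simp add: data_pmf_def t_def case_prod_unfold mult.commute)
  also have "\<dots> \<le> exp (\<Sum>e\<in>upper n. l\<^sup>2 * p / 2 * ((B (fst e) (snd e))\<^sup>2 + (B (snd e) (fst e))\<^sup>2))"
  proof (rule expectation_exp_sum_le[OF finite_upper])
    fix e z d
    have "\<bar>l * c e\<bar> \<le> (1 / 2) * 2"
      unfolding abs_mult by (intro mult_mono) (use l c(1)[of e] in auto)
    hence "\<bar>l * c e\<bar> * \<bar>entry_noise p (t e) z d\<bar> \<le> 1 * 1"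
      by (intro mult_mono abs_entry_noise_le t p) auto
    thus "\<bar>h e z d\<bar> \<le> 1" by (simp add: h_def abs_mult)
  next
    fix e
    show "measure_pmf.expectation (pair_pmf (bernoulli_pmf (t e)) (bernoulli_pmf p)) (\<lambda>(z, d). h e z d) = 0"
      using expectation_entry_noise[OF t p, of e] by (simp add: h_def case_prod_unfold)
    have "measure_pmf.expectation (pair_pmf (bernoulli_pmf (t e)) (bernoulli_pmf p)) (\<lambda>(z, d). (h e z d)\<^sup>2)
      = (l * c e)\<^sup>2 * measure_pmf.expectation (pair_pmf (bernoulli_pmf (t e)) (bernoulli_pmf p))
          (\<lambda>(z, d). (entry_noise p (t e) z d)\<^sup>2)"
      by (simp add: h_def case_prod_unfold power_mult_distrib)
    also have "\<dots> \<le> (l * c e)\<^sup>2 * (p / 4)"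
      by (intro mult_left_mono expectation_entry_noise_sq_le t p) simp
    also have "\<dots> = l\<^sup>2 * p / 4 * (c e)\<^sup>2" by (simp add: power_mult_distrib)
    also have "\<dots> \<le> l\<^sup>2 * p / 4 * (2 * ((B (fst e) (snd e))\<^sup>2 + (B (snd e) (fst e))\<^sup>2))"
      using p by (intro mult_left_mono c(2)) auto
    also have "\<dots> = l\<^sup>2 * p / 2 * ((B (fst e) (snd e))\<^sup>2 + (B (snd e) (fst e))\<^sup>2)"
      by simp
    finally show "measure_pmf.expectation (pair_pmf (bernoulli_pmf (t e)) (bernoulli_pmf p))
        (\<lambda>(z, d). (h e z d)\<^sup>2) \<le> l\<^sup>2 * p / 2 * ((B (fst e) (snd e))\<^sup>2 + (B (snd e) (fst e))\<^sup>2)" .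
  qed
  also have "\<dots> \<le> exp (l\<^sup>2 * p / 2 * frob_inner n B B)"
  proof -
    let ?f = "\<lambda>i j. if i = j then 0 else (B i j)\<^sup>2"
    have "(\<Sum>e\<in>upper n. (B (fst e) (snd e))\<^sup>2 + (B (snd e) (fst e))\<^sup>2)
        = (\<Sum>(i, j)\<in>upper n. ?f i j + ?f j i)"
      by (intro sum.cong) (auto simp: upper_def)
    also have "\<dots> = (\<Sum>i\<in>{1..n}. \<Sum>j\<in>{1..n}. ?f i j)"
      by (rule sum_off_diagonal[symmetric]) simp
    also have "\<dots> \<le> frob_inner n B B"
      unfolding frob_inner_def by (intro sum_mono) (simp add: power2_eq_square)
    finally have "l\<^sup>2 * p / 2 * (\<Sum>e\<in>upper n. (B (fst e) (snd e))\<^sup>2 + (B (snd e) (fst e))\<^sup>2)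
        \<le> l\<^sup>2 * p / 2 * frob_inner n B B"
      using p by (intro mult_left_mono) auto
    thus ?thesis by (simp only: sum_distrib_left[symmetric] exp_le_cancel_iff)
  qed
  finally show ?thesis .
qed

text \<open>The absolute deviation is a maximum over two signs of a linear statistic, so the maximal
  inequality applies with two elements; each summand has variance \<open>p - p^2\<close>, at most
  \<open>p\<close>.\<close>

lemma p_hat_deviation_le:
  assumes \<theta>: "\<theta> \<in> Theta m n" and n: "2 \<le> n" and p: "0 \<le> p" "p \<le> 1" and l: "0 < l" "l \<le> 1"
  shows "measure_pmf.expectation (data_pmf n p \<theta>) (\<lambda>(Z, D). \<bar>p_hat n D - p\<bar>)
    \<le> (ln 2 + l\<^sup>2 * p * real (n choose 2)) / (l * real (n choose 2))"
proof -
  define N where "N = real (n choose 2)"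
  have N: "N > 0" using n by (simp add: N_def)
  define X where "X = (\<lambda>s::real. \<lambda>(Z::nat \<times> nat \<Rightarrow> bool, D). s * (\<Sum>e\<in>upper n. of_bool (D e) - p))"
  define t where "t e = \<theta> (fst e) (snd e)" for e
  have t: "0 \<le> t e" "t e \<le> 1" for e using Theta_bounds[OF \<theta>] by (auto simp: t_def)
  have dev: "(\<Sum>e\<in>upper n. of_bool (D e) - p) = N * (p_hat n D - p)" for D
  proof -
    have "(\<Sum>e\<in>upper n. of_bool (D e) - p) = real (card {e \<in> upper n. D e}) - p * N"
      using finite_upper by (simp add: sum_subtractf card_upper N_def sum_of_bool_eq Collect_conj_eq)
    also have "\<dots> = N * (p_hat n D - p)" using N by (simp add: p_hat_def N_def right_diff_distrib)
    finally show ?thesis .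
  qed
  have mgf: "measure_pmf.expectation (data_pmf n p \<theta>) (\<lambda>x. exp (l * X s x)) \<le> exp (l\<^sup>2 * p * N)"
    if s: "s \<in> {1, -1}" for s
  proof -
    have s': "\<bar>s\<bar> = 1" "s\<^sup>2 = 1" using s by auto
    have "measure_pmf.expectation (data_pmf n p \<theta>) (\<lambda>x. exp (l * X s x))
      = measure_pmf.expectation (pair_pmf (Pi_pmf (upper n) False (\<lambda>e. bernoulli_pmf (t e)))
          (Pi_pmf (upper n) False (\<lambda>_. bernoulli_pmf p)))
          (\<lambda>(Z, D). exp (\<Sum>e\<in>upper n. l * s * (of_bool (D e) - p)))"
      by (simp add: data_pmf_def t_def X_def case_prod_unfold mult.assoc flip: sum_distrib_left)
    also have "\<dots> \<le> exp (\<Sum>e\<in>upper n. l\<^sup>2 * p)"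
    proof (rule expectation_exp_sum_le[OF finite_upper])
      fix e z d
      have "l * \<bar>of_bool d - p\<bar> \<le> 1 * 1" using l p by (intro mult_mono) auto
      thus "\<bar>l * s * (of_bool d - p)\<bar> \<le> 1" using s' l by (simp add: abs_mult)
    next
      fix e
      show "measure_pmf.expectation (pair_pmf (bernoulli_pmf (t e)) (bernoulli_pmf p))
          (\<lambda>(z, d). l * s * (of_bool d - p)) = 0"
        using p t by (subst expectation_pair_finite) (simp_all add: algebra_simps)
      have "measure_pmf.expectation (pair_pmf (bernoulli_pmf (t e)) (bernoulli_pmf p))
          (\<lambda>(z, d). (l * s * (of_bool d - p))\<^sup>2) = l\<^sup>2 * (p - p\<^sup>2)"
        using p t s'(2) by (subst expectation_pair_finite)
          (simp_all add: power_mult_distrib, simp add: power2_eq_square algebra_simps)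
      also have "\<dots> \<le> l\<^sup>2 * p" by (intro mult_left_mono) auto
      finally show "measure_pmf.expectation (pair_pmf (bernoulli_pmf (t e)) (bernoulli_pmf p))
          (\<lambda>(z, d). (l * s * (of_bool d - p))\<^sup>2) \<le> l\<^sup>2 * p" .
    qed
    also have "(\<Sum>e\<in>upper n. l\<^sup>2 * p) = l\<^sup>2 * p * N" by (simp add: card_upper N_def)
    finally show ?thesis .
  qed
  have max: "Max ((\<lambda>s. X s (Z, D)) ` {1, -1}) = N * \<bar>p_hat n D - p\<bar>" for Z D
  proof -
    have "Max ((\<lambda>s. X s (Z, D)) ` {1, -1}) = max (N * (p_hat n D - p)) (- (N * (p_hat n D - p)))"
      by (simp add: X_def dev)
    also have "\<dots> = \<bar>N * (p_hat n D - p)\<bar>" by linarith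
    finally show ?thesis using N by (simp add: abs_mult)
  qed
  have "measure_pmf.expectation (data_pmf n p \<theta>) (\<lambda>x. Max ((\<lambda>s. X s x) ` {1, -1}))
      \<le> (ln (card {1, -1::real}) + l\<^sup>2 * p * N) / l"
    by (rule expectation_Max_le[OF finite_set_data_pmf _ _ l(1) mgf]) auto
  also have "(\<lambda>x. Max ((\<lambda>s. X s x) ` {1, -1})) = (\<lambda>x. N * (case x of (Z, D) \<Rightarrow> \<bar>p_hat n D - p\<bar>))"
    by (rule ext, clarify, simp only: max prod.case)
  finally have "N * measure_pmf.expectation (data_pmf n p \<theta>) (\<lambda>(Z, D). \<bar>p_hat n D - p\<bar>)
      \<le> (ln 2 + l\<^sup>2 * p * N) / l" by simp
  thus ?thesis using N l unfolding N_def[symmetric] by (simp add: field_simps)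
qed

text \<open>Test matrices that express absolute row sums as a maximum of linear functionals, so that
  the same maximal inequality applies. Their squared norm is \<open>n\<close> and there are at most
  \<open>2 * n\<close> of them, which makes the bound smaller by a factor of order \<open>n\<close>
  than for thresholds.\<close>

definition signed_rows :: "nat \<Rightarrow> mat set" where
  "signed_rows n = (\<lambda>(s, a) i j. s * of_bool (i = a)) ` ({1, -1} \<times> {1..n})"

lemma finite_signed_rows: "finite (signed_rows n)"
  by (simp add: signed_rows_def)

lemma card_signed_rows_le: "card (signed_rows n) \<le> 2 * n"
proof -
  have "card (signed_rows n) \<le> card ({1, -1::real} \<times> {1..n})"
    unfolding signed_rows_def by (rule card_image_le) simp
  thus ?thesis by (simp add: card_cartesian_product)
qed

lemma frob_inner_row:
  assumes "a \<in> {1..n}"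
  shows "frob_inner n X (\<lambda>i j. s * of_bool (i = a)) = s * row_sum n X a"
proof -
  have "frob_inner n X (\<lambda>i j. s * of_bool (i = a)) = (\<Sum>i\<in>{1..n}. if i = a then s * row_sum n X i else 0)"
    unfolding frob_inner_def row_sum_def
    by (intro sum.cong) (auto simp: sum_distrib_left mult.commute)
  thus ?thesis using assms by simp
qed

lemma abs_row_sum_le_signed_rows:
  assumes "a \<in> {1..n}"
  shows "\<bar>row_sum n X a\<bar> \<le> Max (frob_inner n X ` signed_rows n)"
proof -
  have "s * row_sum n X a \<le> Max (frob_inner n X ` signed_rows n)" if "s \<in> {1, -1}" for s
  proof -
    have "(\<lambda>i j. s * of_bool (i = a)) \<in> signed_rows n"
      unfolding signed_rows_def using that assms by (intro image_eqI[of _ _ "(s, a)"]) auto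
    from Max_ge[OF finite_imageI[OF finite_signed_rows] imageI[OF this, of "frob_inner n X"]]
    show ?thesis by (simp only: frob_inner_row[OF assms])
  qed
  from this[of 1] this[of "-1"] show ?thesis by simp
qed

lemma signed_rows_abs_le: "B \<in> signed_rows n \<Longrightarrow> \<bar>B i j\<bar> \<le> 1"
  by (auto simp: signed_rows_def)

lemma signed_rows_norm:
  assumes "B \<in> signed_rows n"
  shows "frob_inner n B B = n"
proof -
  from assms obtain x where x: "x \<in> {1, -1} \<times> {1..n}" "B = (\<lambda>i j. fst x * of_bool (i = snd x))"
    unfolding signed_rows_def case_prod_unfold by blast
  define s a where "s = fst x" and "a = snd x"
  have B: "B = (\<lambda>i j. s * of_bool (i = a))" and s: "s = 1 \<or> s = -1" and a: "a \<in> {1..n}"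
    using x by (auto simp: s_def a_def)
  have "frob_inner n B B = s * row_sum n B a"
    using frob_inner_row[OF a, of B s] by (simp only: B)
  also have "\<dots> = s * (s * n)" by (simp add: row_sum_def B)
  finally show ?thesis using s by auto
qed

lemma expectation_Max_noise_le:
  assumes \<theta>: "\<theta> \<in> Theta m n" and p: "0 \<le> p" "p \<le> 1" and l: "0 < l" "l \<le> 1 / 2"
    and F: "finite F" "F \<noteq> {}" "\<And>B i j. B \<in> F \<Longrightarrow> \<bar>B i j\<bar> \<le> 1"
    and v: "\<And>B. B \<in> F \<Longrightarrow> frob_inner n B B \<le> v"
  shows "measure_pmf.expectation (data_pmf n p \<theta>)
      (\<lambda>(Z, D). Max (frob_inner n (noise m n p \<theta> Z D) ` F)) \<le> (ln (card F) + l\<^sup>2 * p / 2 * v) / l"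
proof -
  let ?X = "\<lambda>B (Z, D). frob_inner n (noise m n p \<theta> Z D) B"
  have "measure_pmf.expectation (data_pmf n p \<theta>) (\<lambda>x. Max ((\<lambda>B. ?X B x) ` F))
      \<le> (ln (card F) + l\<^sup>2 * p / 2 * v) / l"
  proof (rule expectation_Max_le[OF finite_set_data_pmf F(1,2) l(1)])
    fix B assume B: "B \<in> F"
    have "measure_pmf.expectation (data_pmf n p \<theta>) (\<lambda>x. exp (l * ?X B x)) \<le> exp (l\<^sup>2 * p / 2 * frob_inner n B B)"
      using noise_mgf_le[OF \<theta> p l F(3)[OF B]] by (simp add: case_prod_unfold)
    also have "\<dots> \<le> exp (l\<^sup>2 * p / 2 * v)"
      using v[OF B] p by (simp add: mult_left_mono)
    finally show "measure_pmf.expectation (data_pmf n p \<theta>) (\<lambda>x. exp (l * ?X B x)) \<le> exp (l\<^sup>2 * p / 2 * v)" .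
  qed
  thus ?thesis by (simp add: case_prod_unfold)
qed

lemma ln_card_signed_thresholds_le:
  assumes "2 \<le> n"
  shows "ln (card (signed_thresholds n)) \<le> 4 * real n * ln (real n)"
proof -
  have "n + 1 \<le> 2 * n" using assms by simp
  also have "\<dots> \<le> n\<^sup>2" using assms by (simp add: power2_eq_square)
  finally have n1: "n + 1 \<le> n\<^sup>2" .
  have "2 \<le> n ^ n" using assms self_le_power[of n n] by linarith
  have "card (signed_thresholds n) \<le> 2 * fact n * (n + 1) ^ n" by (rule card_signed_thresholds_le)
  also have "\<dots> \<le> n ^ n * n ^ n * (n\<^sup>2) ^ n"
    using fact_le_power[of n, where 'a = nat] \<open>2 \<le> n ^ n\<close> n1 by (intro mult_le_mono power_mono) auto
  also have "\<dots> = n ^ (4 * n)" by (simp flip: power_mult power_add)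
  finally have "real (card (signed_thresholds n)) \<le> real n ^ (4 * n)"
    by (metis of_nat_le_iff of_nat_power)
  moreover have "0 < card (signed_thresholds n)"
    using finite_signed_thresholds signed_thresholds_nonempty by (simp add: card_gt_0_iff)
  ultimately have "ln (card (signed_thresholds n)) \<le> ln (real n ^ (4 * n))"
    using assms by (subst ln_le_cancel_iff) auto
  thus ?thesis using assms by (simp add: ln_realpow)
qed

text \<open>From \<open>n \<ge> 3\<close> comes \<open>ln n \<ge> 1\<close>, hence
  \<open>1 / n \<le> p / 2\<close>: whenever \<open>p_hat\<close> is at least \<open>p / 2\<close>,
  the estimator uses its projection branch.\<close>

lemma risk_le:
  assumes \<theta>: "\<theta> \<in> Theta m n" and n: "3 \<le> n" and p: "p \<le> 1" "2 * ln (real n) / real n \<le> p"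
  shows "risk m n p \<theta> \<le> 202 * ((real n)\<^sup>2 * sqrt (ln (real n) / (real n * p)))"
proof -
  define s where "s = sqrt (ln (real n) / (real n * p))"
  define \<xi> where "\<xi> = (\<lambda>(Z, D). noise m n p \<theta> Z D)"
  define M where "M x = Max (frob_inner n (\<xi> x) ` signed_thresholds n)" for x
  define \<delta> where "\<delta> x = Max (frob_inner n (\<xi> x) ` signed_rows n)" for x
  define dev where "dev = (\<lambda>(Z::nat \<times> nat \<Rightarrow> bool, D). \<bar>p_hat n D - p\<bar>)"
  \<comment> \<open>The coefficient 6 covers the 4 of the projection branch; if
    \<open>p_hat < p / 2\<close>, then \<open>dev / p\<close> is at least 1/2 and this term alone
    exceeds the trivial loss \<open>n^2\<close>.\<close>
  define H where "H x = 16 * M x / p + 6 * (real n)\<^sup>2 * (dev x / p) + 2 * n * (4 * \<delta> x / p + 6)" for x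
  let ?E = "measure_pmf.expectation (data_pmf n p \<theta>)"
  note [simp] = integrable_measure_pmf_finite[OF finite_set_data_pmf]

  have "exp 1 \<le> real n" using exp_le n by linarith
  hence ln1: "1 \<le> ln (real n)" using n by (simp add: ln_ge_iff)
  have "0 < 2 * ln (real n) / real n" using ln1 n by simp
  hence p0: "0 < p" using p(2) by linarith
  have x: "0 < ln (real n) / (real n * p)" "ln (real n) / (real n * p) \<le> 1 / 2"
    using p(2) p0 n ln1 by (auto simp: field_simps)
  have s0: "0 < s" using x by (simp add: s_def)
  have s1: "s \<le> 1"
    unfolding s_def real_sqrt_le_1_iff by (rule order.trans[OF x(2)]) simp
  have s2: "s\<^sup>2 = ln (real n) / (real n * p)" using x by (simp add: s_def)
  \<comment> \<open>This identity puts entropy and variance terms on the same scale in all three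
    expectations below.\<close>
  have ln_eq: "ln (real n) = s\<^sup>2 * real n * p" using p0 n by (simp add: s2)
  \<comment> \<open>Used to absorb the additive 6 of the sorting error into a multiple of
    \<open>n * s\<close>.\<close>
  have ns: "1 \<le> real n * s"
  proof -
    have "1 \<le> real n * real n * (ln (real n) / (real n * p))"
      using ln1 n p p0 mult_mono[of 1 "real n" p "ln (real n)"] by (simp add: field_simps)
    hence "1\<^sup>2 \<le> (real n * s)\<^sup>2"
      unfolding power_mult_distrib s2 by (simp only: power2_eq_square mult_1)
    thus ?thesis by (rule power2_le_imp_le) (use s0 in simp)
  qed
  have l: "0 < s / 2" "s / 2 \<le> 1 / 2" "s / 2 \<le> 1" using s0 s1 by auto

  have EM: "?E M \<le> 33 / 4 * ((real n)\<^sup>2 * p * s)"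
  proof -
    have "?E M \<le> (ln (card (signed_thresholds n)) + (s / 2)\<^sup>2 * p / 2 * (real n)\<^sup>2) / (s / 2)"
    proof -
      have "M = (\<lambda>(Z, D). Max (frob_inner n (noise m n p \<theta> Z D) ` signed_thresholds n))"
        by (auto simp: M_def \<xi>_def)
      moreover have "frob_inner n B B \<le> (real n)\<^sup>2" if "B \<in> signed_thresholds n" for B
        using frob_norm_sq_le[of B n] signed_thresholds_abs_le[OF that] by (simp only: frob_norm_sq)
      ultimately show ?thesis
        using p0 p(1) l by (simp only:)
          (intro expectation_Max_noise_le[OF \<theta>] finite_signed_thresholds
            signed_thresholds_nonempty signed_thresholds_abs_le, auto)
    qed
    also have "\<dots> \<le> (4 * real n * ln (real n) + (s / 2)\<^sup>2 * p / 2 * (real n)\<^sup>2) / (s / 2)"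
      using ln_card_signed_thresholds_le[of n] n s0 by (intro divide_right_mono add_mono) auto
    \<comment> \<open>The numerator is \<open>(4 + 1/8) * s^2 * n^2 * p\<close>, and division by
      \<open>s / 2\<close> doubles the constant.\<close>
    also have "\<dots> = 33 / 4 * ((real n)\<^sup>2 * p * s)"
      unfolding ln_eq using s0 by (simp add: field_simps power2_eq_square)
    finally show ?thesis .
  qed
  have E\<delta>: "?E \<delta> \<le> 17 / 4 * (real n * p * s)"
  proof -
    have ne: "signed_rows n \<noteq> {}" using n by (auto simp: signed_rows_def)
    have "real (card (signed_rows n)) \<le> real (2 * n)" using card_signed_rows_le by (rule of_nat_mono)
    also have "\<dots> \<le> real n ^ 2" using n by (simp add: power2_eq_square)
    finally have "ln (card (signed_rows n)) \<le> ln (real n ^ 2)"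
      using ne finite_signed_rows n by (subst ln_le_cancel_iff) (auto simp: card_gt_0_iff)
    hence card: "ln (card (signed_rows n)) \<le> 2 * ln (real n)" using n by (simp add: ln_realpow)
    have "?E \<delta> \<le> (ln (card (signed_rows n)) + (s / 2)\<^sup>2 * p / 2 * real n) / (s / 2)"
    proof -
      have "\<delta> = (\<lambda>(Z, D). Max (frob_inner n (noise m n p \<theta> Z D) ` signed_rows n))"
        by (auto simp: \<delta>_def \<xi>_def)
      thus ?thesis
        using p0 p(1) l by (simp only:)
          (intro expectation_Max_noise_le[OF \<theta>] finite_signed_rows ne signed_rows_abs_le,
            auto simp: signed_rows_norm)
    qed
    also have "\<dots> \<le> (2 * ln (real n) + (s / 2)\<^sup>2 * p / 2 * real n) / (s / 2)"
      using card s0 by (intro divide_right_mono add_mono) auto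
    also have "\<dots> = 17 / 4 * (real n * p * s)"
      unfolding ln_eq using s0 by (simp add: field_simps power2_eq_square)
    finally show ?thesis .
  qed
  have Edev: "?E dev \<le> 4 * (p * s)"
  proof -
    define N where "N = real (n choose 2)"
    have "real (n choose 2) = real n * (real n - 1) / 2"
      using n by (simp add: choose_two real_of_nat_div of_nat_diff)
    moreover have "3 * real n \<le> real n * real n" using n by simp
    ultimately have N: "(real n)\<^sup>2 / 3 \<le> N" by (simp add: N_def power2_eq_square field_simps)
    have "0 < (real n)\<^sup>2 / 3" using n by simp
    hence N0: "0 < N" using N by linarith
    have ln2: "ln 2 \<le> ln (real n)" using n by simp
    have "?E dev \<le> (ln 2 + (s / 2)\<^sup>2 * p * N) / (s / 2 * N)"
      unfolding dev_def N_def using p0 n by (intro p_hat_deviation_le[OF \<theta> _ _ p(1) l(1,3)]) auto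
    also have "\<dots> \<le> (ln (real n) + (s / 2)\<^sup>2 * p * N) / (s / 2 * N)"
      using s0 N0 ln2 by (intro divide_right_mono) auto
    also have "\<dots> = 2 * (s * p) * (real n / N) + s * p / 2"
      unfolding ln_eq using s0 N0 by (simp add: field_simps power2_eq_square)
    also have "\<dots> \<le> 2 * (s * p) * 1 + s * p / 2"
    proof -
      have "real n \<le> (real n)\<^sup>2 / 3" using n by (simp add: power2_eq_square)
      hence "real n / N \<le> 1" using N N0 by simp
      thus ?thesis using s0 p0 by (intro add_right_mono mult_left_mono) auto
    qed
    also have "\<dots> \<le> 4 * (p * s)" using s0 p0 by simp
    finally show ?thesis .
  qed

  have "risk m n p \<theta> \<le> ?E H"
  proof (rule risk_le_expectation)
    fix Z D \<sigma> assume \<sigma>: "\<sigma> \<in> sorting_perms n (data_matrix m n Z D)"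
    let ?loss = "(frob_norm n (\<lambda>i j. theta_hat m n (data_matrix m n Z D) (p_hat n D) \<sigma> i j - \<theta> i j))\<^sup>2"
    have le_M: "frob_inner n (noise m n p \<theta> Z D) B \<le> M (Z, D)" if "B \<in> signed_thresholds n" for B
      unfolding M_def \<xi>_def using that finite_signed_thresholds by (intro Max_ge) auto
    have le_\<delta>: "\<bar>row_sum n (noise m n p \<theta> Z D) a\<bar> \<le> \<delta> (Z, D)" if "a \<in> {1..n}" for a
      unfolding \<delta>_def \<xi>_def using abs_row_sum_le_signed_rows[OF that] by simp
    have M0: "0 \<le> M (Z, D)"
    proof -
      obtain t where t: "t \<in> ordered_params m n" using \<theta> by (auto simp: Theta_def)
      have "r * frob_inner n (permute (noise m n p \<theta> Z D) id) t \<le> M (Z, D)" if "r \<in> {1, -1}" for r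
        using inner_ordered_le_signed_threshold[OF t permutes_id, of "noise m n p \<theta> Z D" r]
          noise_diag[OF \<theta>] that le_M by fastforce
      from this[of 1] this[of "-1"] show ?thesis by simp
    qed
    have \<delta>0: "0 \<le> \<delta> (Z, D)" using le_\<delta>[of 1] n by auto
    show "?loss \<le> H (Z, D)"
    proof (cases "p / 2 \<le> p_hat n D")
      case True
      have "1 / real n \<le> p / 2" using p(2) ln1 n by (simp add: field_simps)
      hence "1 / real n \<le> p_hat n D" using True by linarith
      from theta_hat_loss_bound[OF \<theta> \<sigma> p0 True this le_M le_\<delta>]
      have "?loss \<le> 16 * M (Z, D) / p + 4 * (real n)\<^sup>2 * (dev (Z, D) / p) + 2 * n * (4 * \<delta> (Z, D) / p + 6)"
        by (simp add: dev_def)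
      moreover have "0 \<le> (real n)\<^sup>2 * (dev (Z, D) / p)" using p0 by (simp add: dev_def)
      ultimately show ?thesis by (simp add: H_def)
    next
      case False
      have "1 / 2 \<le> dev (Z, D) / p" using False p0 by (simp add: dev_def field_simps)
      hence "(real n)\<^sup>2 * (1 / 2) \<le> (real n)\<^sup>2 * (dev (Z, D) / p)" by (rule mult_left_mono) simp
      moreover have "0 \<le> 16 * M (Z, D) / p" "0 \<le> 2 * n * (4 * \<delta> (Z, D) / p + 6)"
        using M0 \<delta>0 p0 by simp_all
      ultimately show ?thesis
        using theta_hat_loss_le[OF \<theta>, of "data_matrix m n Z D" "p_hat n D" \<sigma>]
          zero_le_power2[of "real n"] unfolding H_def by linarith
    qed
  qed
  also have "?E H = 16 * ?E M / p + 6 * (real n)\<^sup>2 * (?E dev / p) + 2 * n * (4 * ?E \<delta> / p + 6)"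
    unfolding H_def by simp
  also have "\<dots> \<le> 16 * (33 / 4 * ((real n)\<^sup>2 * p * s)) / p + 6 * (real n)\<^sup>2 * (4 * (p * s) / p)
      + 2 * n * (4 * (17 / 4 * (real n * p * s)) / p + 6 * (real n * s))"
    using EM E\<delta> Edev ns p0
    by (intro add_mono mult_left_mono divide_right_mono) auto
  \<comment> \<open>The sum is 132 from thresholds, 24 from \<open>p_hat\<close>, 34 from row sums
    and 12 from the additive sorting error.\<close>
  also have "\<dots> = 202 * ((real n)\<^sup>2 * s)"
    using p0 by (simp add: field_simps power2_eq_square)
  finally show ?thesis by (simp add: s_def)
qed

theorem corollary2p1:
  "\<exists>C::real. \<forall>(m::model) (n::nat) (p::real).
     2 \<le> n \<longrightarrow> 0 \<le> p \<longrightarrow> p \<le> 1 \<longrightarrow> p \<ge> 2 * ln (real n) / real n \<longrightarrow>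
     (SUP \<theta>\<in>Theta m n. ereal (1 / (real n)\<^sup>2 * risk m n p \<theta>))
       \<le> ereal (C * ((ln (real n))\<^sup>2 / (real n * p) + sqrt (ln (real n) / (real n * p))))"
proof (intro exI[of _ 202] allI impI SUP_least)
  fix m :: model and n :: nat and p :: real and \<theta>
  assume n: "2 \<le> n" and p: "0 \<le> p" "p \<le> 1" "2 * ln (real n) / real n \<le> p" and \<theta>: "\<theta> \<in> Theta m n"
  let ?s = "sqrt (ln (real n) / (real n * p))"
  have "risk m n p \<theta> \<le> 202 * ((real n)\<^sup>2 * ?s)"
  proof (cases "n = 2")
    \<comment> \<open>For \<open>n = 2\<close> the logarithm is below 1, but
      \<open>p \<le> 1\<close> keeps the square root at least 1/2 and the trivial loss
      suffices.\<close>
    case True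
    have "0 < 2 * ln (real n) / real n" using True by simp
    hence p0: "0 < p" using p(3) by linarith
    have "1 / 4 \<le> ln 2 / (2 * p)" using p p0 ln2_ge_two_thirds by (simp add: field_simps)
    hence "sqrt (1 / 4) \<le> ?s" using True by (intro real_sqrt_le_mono) simp
    hence "1 / 2 \<le> ?s" by (simp add: real_sqrt_divide)
    thus ?thesis using risk_le_trivial[OF \<theta>, of p] True by simp
  next
    case False
    thus ?thesis using risk_le[OF \<theta> _ p(2,3)] n by simp
  qed
  hence "1 / (real n)\<^sup>2 * risk m n p \<theta> \<le> 202 * ?s"
    using n by (simp add: field_simps)
  also have "\<dots> \<le> 202 * ((ln (real n))\<^sup>2 / (real n * p) + ?s)" using p by simp
  finally show "ereal (1 / (real n)\<^sup>2 * risk m n p \<theta>)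
      \<le> ereal (202 * ((ln (real n))\<^sup>2 / (real n * p) + ?s))" by simp
qed

end
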